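(* Let $J=\begin{pmatrix}0&0&1\\0&1&0\\1&0&0\end{pmatrix}$, let $\mathcal{O}_7$ be the ring of integers of $\mathbb{Q}(i\sqrt7)$, and let $\Gamma=PU(J,\mathcal{O}_7)$. There are precisely two conjugacy classes of complex reflections in $\Gamma$. They are represented by $$R=\begin{pmatrix}1&0&0\\0&-1&0\\0&0&1\end{pmatrix},\qquad I=\begin{pmatrix}0&0&1\\0&-1&0\\1&0&0\end{pmatrix},$$ both of order $2$. The mirror of $R$ is polar to $v=(0,1,0)$, for which $\langle v,v\rangle=1$, and the mirror of $I$ is polar to $v=(1,0,1)$, for which $\langle v,v\rangle=2$.
   Context: Write $\langle v,w\rangle=w^*Jv$ for $v,w\in\mathbb{C}^3$; this Hermitian form has signature $(2,1)$. $U(J)$ is the group of complex $3\times3$ matrices preserving this form, $U(J,\mathcal{O}_7)=U(J)\cap GL(3,\mathcal{O}_7)$, and $PU(J,\mathcal{O}_7)=U(J,\mathcal{O}_7)/\{\pm Id\}$; elements of $PU(J,\mathcal{O}_7)$ are denoted by matrix representatives. The complex hyperbolic plane $H^2_{\mathbb{C}}$ is the set of complex lines in $\mathbb{C}^3$ spanned by vectors $v$ with $\langle v,v\rangle<0$. For $v$ with $\langle v,v\rangle>0$, the complex line of $H^2_{\mathbb{C}}$ polar to $v$ is the set of points of $H^2_{\mathbb{C}}$ represented by vectors in $v^\perp$. A complex reflection in $\Gamma$ is a non-trivial finite-order element whose fixed point set in $H^2_{\mathbb{C}}$ is a complex line, called its mirror. *)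

theory Defs
  imports
    "HOL-Analysis.Analysis"
    "HOL-Computational_Algebra.Polynomial"
    "HOL-Algebra.Coset"
    "HOL-Algebra.Group_Action"
    "HOL-Algebra.Multiplicative_Group"
begin

section \<open>The Hermitian form\<close>

definition J :: "complex^3^3" where
  "J = vector [vector [0, 0, 1],
               vector [0, 1, 0],
               vector [1, 0, 0]]"

text \<open>\<open>herm v w\<close> is \<open>w\<^sup>* J v\<close>: linear in \<open>v\<close>, conjugate-linear in \<open>w\<close>.\<close>

definition herm :: "complex^3 \<Rightarrow> complex^3 \<Rightarrow> complex" where
  "herm v w = (\<Sum>i\<in>UNIV. cnj (w $ i) * (J *v v) $ i)"

lemma herm_expand: "herm v w = cnj (w $ 1) * v $ 3 + cnj (w $ 2) * v $ 2 + cnj (w $ 3) * v $ 1"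
  by (simp add: herm_def J_def sum_3 matrix_vector_mult_def vector_3)

text \<open>Since \<open>herm v v\<close> is always real, its sign is the sign of \<open>Re (herm v v)\<close>.\<close>

lemma herm_self_real: "herm v v \<in> \<real>"
  by (simp add: herm_expand complex_is_Real_iff)

section \<open>The group \<open>PU(J, O7)\<close>\<close>

definition Q_sqrt_minus7 :: "complex set" where
  "Q_sqrt_minus7 = {a + b * (\<i> * of_real (sqrt 7)) | a b. a \<in> \<rat> \<and> b \<in> \<rat>}"

definition O7 :: "complex set" where
  "O7 = {z \<in> Q_sqrt_minus7. algebraic_int z}"

definition GL3_O7 :: "(complex^3^3) set" where
  "GL3_O7 = {A. (\<forall>i j. A $ i $ j \<in> O7) \<and>
                (\<exists>B. (\<forall>i j. B $ i $ j \<in> O7) \<and> A ** B = mat 1 \<and> B ** A = mat 1)}"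

definition UJ :: "(complex^3^3) set" where
  "UJ = {A. \<forall>v w. herm (A *v v) (A *v w) = herm v w}"

definition UJ_O7 :: "(complex^3^3) monoid" where
  "UJ_O7 = \<lparr>carrier = UJ \<inter> GL3_O7, mult = (**), one = mat 1\<rparr>"

definition PU_J_O7 :: "(complex^3^3) set monoid" where
  "PU_J_O7 = UJ_O7 Mod {mat 1, - mat 1}"

definition pclass :: "complex^3^3 \<Rightarrow> (complex^3^3) set" where
  "pclass A = {mat 1, - mat 1} #>\<^bsub>UJ_O7\<^esub> A"

lemma neg_mat_1_mult: "(- mat 1) ** A = - (A :: complex^3^3)"
  by (simp add: matrix_matrix_mult_def mat_def vec_eq_iff if_distrib if_distribR sum_negf cong: if_cong)

lemma pclass_eq: "pclass A = {A, - A}"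
  by (auto simp: pclass_def r_coset_def UJ_O7_def neg_mat_1_mult)

definition R_mat :: "complex^3^3" where
  "R_mat = vector [vector [1, 0, 0],
                   vector [0, -1, 0],
                   vector [0, 0, 1]]"

definition I_mat :: "complex^3^3" where
  "I_mat = vector [vector [0, 0, 1],
                   vector [0, -1, 0],
                   vector [1, 0, 0]]"

section \<open>The complex hyperbolic plane and the action of \<open>PU_J_O7\<close>\<close>

definition H2C :: "(complex^3) set set" where
  "H2C = {vec.span {v} | v. Re (herm v v) < 0}"

definition polar :: "complex^3 \<Rightarrow> (complex^3) set set" where
  "polar v = {L \<in> H2C. \<exists>w. herm w v = 0 \<and> L = vec.span {w}}"

definition is_complex_line :: "(complex^3) set set \<Rightarrow> bool" where
  "is_complex_line S \<longleftrightarrow> (\<exists>v. Re (herm v v) > 0 \<and> S = polar v)"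

text \<open>The two representatives \<open>A\<close> and \<open>- A\<close> of an element of \<open>PU_J_O7\<close> map a linear subspace to the
  same subspace, so the union below is just the image under any one of them.\<close>

definition act :: "(complex^3^3) set \<Rightarrow> (complex^3) set \<Rightarrow> (complex^3) set" where
  "act g L = (\<Union>A\<in>g. (*v) A ` L)"

lemma act_pclass:
  fixes L :: "(complex^3) set"
  assumes "vec.subspace L"
  shows "act (pclass A) L = (*v) A ` L"
proof -
  have "(- A) *v x = A *v (- x)" for x :: "complex^3"
    by (simp add: matrix_vector_mult_def vec_eq_iff sum_negf)
  moreover have "- x \<in> L" if "x \<in> L" for x
    using vec.subspace_neg[OF assms that] .
  ultimately show ?thesis
    unfolding act_def pclass_eq by auto
qed

definition fixed_points :: "(complex^3^3) set \<Rightarrow> (complex^3) set set" where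
  "fixed_points g = {L \<in> H2C. act g L = L}"

definition is_complex_reflection :: "(complex^3^3) set \<Rightarrow> bool" where
  "is_complex_reflection g \<longleftrightarrow>
     g \<in> carrier PU_J_O7 \<and> g \<noteq> \<one>\<^bsub>PU_J_O7\<^esub> \<and>
     (\<exists>n::nat. n > 0 \<and> g [^]\<^bsub>PU_J_O7\<^esub> n = \<one>\<^bsub>PU_J_O7\<^esub>) \<and>
     is_complex_line (fixed_points g)"

abbreviation mirror :: "(complex^3^3) set \<Rightarrow> (complex^3) set set" where
  "mirror g \<equiv> fixed_points g"

definition conj_class :: "('a, 'b) monoid_scheme \<Rightarrow> 'a \<Rightarrow> 'a set" where
  "conj_class G g = orbit G (\<lambda>h. \<lambda>x\<in>carrier G. h \<otimes>\<^bsub>G\<^esub> x \<otimes>\<^bsub>G\<^esub> inv\<^bsub>G\<^esub> h) g"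

end

(*
  A finite-order element with a complex line of fixed points acts on the orthogonal complement of a
  positive vector as a root of unity, and on that vector as another one. The first eigenvalue is a double
  root, hence lies in Q(sqrt(-7)); so both are units of O_7, that is, signs, and the reflection is
  x |-> x - 2 <x,v>/<v,v> v for a primitive integral vector v. Integrality forces <v,v> to divide 2, so
  <v,v> is 1 or 2.

  It remains to see that U(J, O_7) is transitive on primitive vectors of norm 1 and of norm 2. Hermite
  reduction in the rank two lattice orthogonal to v, over the norm-Euclidean ring O_7, yields a short list
  of Gram matrices. For norm 1 each of them contains a hyperbolic pair, which together with v is a
  basis with Gram matrix J. For norm 2 each of them contains a vector of norm 1; moving it to (0,1,0)
  leaves v = (p,0,q), and because O_7 / 2 is a product of two fields with two elements, the vector
  f = ((p + conj p)/2, 0, (q - conj q)/2) is integral; f and v - f form a hyperbolic pair.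

  The two classes differ because a vector of norm 1 is not an integral multiple of (1,0,1).
*)
theory Submission
  imports Defs
begin

section \<open>The ring of integers\<close>

definition omega :: complex where
  "omega = (1 + \<i> * of_real (sqrt 7)) / 2"

text \<open>An explicit integral basis for \<open>O7\<close>. The two sets are identified in
  \<open>O7_eq_Zomega\<close>, and every integrality question is settled in these
  coordinates.\<close>

definition Zomega :: "complex set" where
  "Zomega = {of_int m + of_int k * omega | m k. True}"

lemma Re_omega [simp]: "Re omega = 1 / 2" and Im_omega [simp]: "Im omega = sqrt 7 / 2"
  by (simp_all add: omega_def)

lemma sqrt7_sq [simp]: "sqrt 7 * sqrt 7 = 7" "sqrt 7 * (sqrt 7 * x) = 7 * x"
  by (simp_all flip: mult.assoc)

lemma omega_sq: "omega * omega = omega - 2"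
  by (simp add: complex_eq_iff)

lemma cnj_omega: "cnj omega = 1 - omega"
  by (simp add: complex_eq_iff)

lemma ZomegaI [intro?]: "of_int m + of_int k * omega \<in> Zomega"
  unfolding Zomega_def by blast

lemma ZomegaE:
  assumes "z \<in> Zomega"
  obtains m k where "z = of_int m + of_int k * omega"
  using assms unfolding Zomega_def by blast

lemma Zomega_of_int [simp, intro]: "of_int m \<in> Zomega"
  using ZomegaI[of m 0] by simp

lemma Zomega_0 [simp, intro]: "0 \<in> Zomega" and Zomega_1 [simp, intro]: "1 \<in> Zomega"
  using Zomega_of_int[of 0] Zomega_of_int[of 1] by simp_all

lemma Zomega_numeral [simp, intro]: "numeral w \<in> Zomega"
  using Zomega_of_int[of "numeral w"] by simp

lemma Zomega_omega [simp, intro]: "omega \<in> Zomega"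
  using ZomegaI[of 0 1] by simp

lemma Zomega_add [intro]: "x + y \<in> Zomega" if xy: "x \<in> Zomega" "y \<in> Zomega"
proof -
  obtain m k m' k' where "x = of_int m + of_int k * omega" "y = of_int m' + of_int k' * omega"
    using xy unfolding Zomega_def by blast
  then have "x + y = of_int (m + m') + of_int (k + k') * omega"
    by (simp add: algebra_simps)
  then show ?thesis
    using ZomegaI by metis
qed

lemma Zomega_minus [intro]: "- x \<in> Zomega" if x: "x \<in> Zomega"
proof -
  obtain m k where "x = of_int m + of_int k * omega"
    using x by (elim ZomegaE)
  then have "- x = of_int (- m) + of_int (- k) * omega"
    by simp
  then show ?thesis
    using ZomegaI by metis
qed

lemma Zomega_diff [intro]: "x - y \<in> Zomega" if "x \<in> Zomega" "y \<in> Zomega"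
  using Zomega_add[OF that(1) Zomega_minus[OF that(2)]] by simp

lemma Zomega_mult [intro]: "x * y \<in> Zomega" if xy: "x \<in> Zomega" "y \<in> Zomega"
proof -
  obtain m k m' k' where eq: "x = of_int m + of_int k * omega" "y = of_int m' + of_int k' * omega"
    using xy unfolding Zomega_def by blast
  have "x * y = of_int m * of_int m' + (of_int m * of_int k' + of_int k * of_int m') * omega
      + of_int k * of_int k' * (omega * omega)"
    unfolding eq by (simp add: algebra_simps)
  also have "\<dots> = of_int (m * m' - 2 * k * k') + of_int (m * k' + k * m' + k * k') * omega"
    unfolding omega_sq by (simp add: algebra_simps)
  finally show ?thesis
    using ZomegaI by metis
qed

lemma Zomega_cnj [intro]: "cnj x \<in> Zomega" if x: "x \<in> Zomega"
proof -
  obtain m k where "x = of_int m + of_int k * omega"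
    using x by (elim ZomegaE)
  then have "cnj x = of_int m + of_int k * (1 - omega)"
    by (simp add: cnj_omega)
  then show ?thesis
    by (auto intro!: Zomega_add Zomega_mult Zomega_diff)
qed

lemma Zomega_power [intro]: "x ^ n \<in> Zomega" if "x \<in> Zomega"
  by (induction n) (use that in auto)

lemma Zomega_sum [intro]: "sum f A \<in> Zomega" if "\<And>i. i \<in> A \<Longrightarrow> f i \<in> Zomega"
  using that by (induction A rule: infinite_finite_induct) auto

section \<open>Norm equations, units and Euclidean division\<close>

lemma Zomega_Re_Im:
  assumes "z \<in> Zomega"
  obtains m k :: int where "2 * Re z = of_int m" "2 * Im z = of_int k * sqrt 7" "even (m - k)"
    "z = of_int ((m - k) div 2) + of_int k * omega"
proof -
  obtain m k where z: "z = of_int m + of_int k * omega"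
    using assms by (elim ZomegaE)
  show ?thesis
    by (rule that[of "2 * m + k" k]) (simp_all add: z)
qed

lemma Zomega_cmod_sq:
  assumes "z \<in> Zomega"
  obtains n :: nat where "(cmod z)\<^sup>2 = of_nat n"
proof -
  obtain m k where z: "z = of_int m + of_int k * omega"
    using assms by (elim ZomegaE)
  have "(cmod z)\<^sup>2 = (of_int m + of_int k / 2)\<^sup>2 + (of_int k * sqrt 7 / 2)\<^sup>2"
    unfolding cmod_power2 z by simp
  also have "\<dots> = of_int (m * m + m * k + 2 * k * k)"
    by (simp add: power2_eq_square field_simps)
  finally have *: "(cmod z)\<^sup>2 = of_int (m * m + m * k + 2 * k * k)" .
  moreover from this have "m * m + m * k + 2 * k * k \<ge> 0"
    by (metis of_int_0_le_iff zero_le_power2)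
  ultimately show ?thesis
    using that[of "nat (m * m + m * k + 2 * k * k)"] by simp
qed

lemma Zomega_real:
  assumes "z \<in> Zomega" "z \<in> \<real>"
  obtains m :: int where "z = of_int m"
proof -
  obtain m k where z: "z = of_int m + of_int k * omega"
    using assms by (elim ZomegaE)
  with assms(2) have "k = 0"
    by (simp add: complex_is_Real_iff)
  then show ?thesis
    using that z by simp
qed

text \<open>In the doubled coordinates of \<open>Zomega_Re_Im\<close> the norm equation reads
  \<open>m\<^sup>2 + 7 * k\<^sup>2 = 4\<close>, and the weight 7 forces \<open>k = 0\<close>. This
  determines the units that can occur as eigenvalues.\<close>

lemma Zomega_cmod_1:
  assumes "z \<in> Zomega" "cmod z = 1"
  shows "z = 1 \<or> z = -1"
proof -
  obtain m k where mk: "2 * Re z = of_int m" "2 * Im z = of_int k * sqrt 7"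
    using assms(1) by (rule Zomega_Re_Im)
  have "(2 * Re z)\<^sup>2 + (2 * Im z)\<^sup>2 = 4 * (cmod z)\<^sup>2"
    unfolding cmod_power2 by (simp add: power2_eq_square)
  then have "of_int (m\<^sup>2 + 7 * k\<^sup>2) = (of_int 4 :: real)"
    unfolding mk assms(2) by (simp add: power_mult_distrib)
  then have eq: "m\<^sup>2 + 7 * k\<^sup>2 = 4"
    by (simp only: of_int_eq_iff)
  have "k = 0"
  proof (rule ccontr)
    assume "k \<noteq> 0"
    then have "k\<^sup>2 > 0" by simp
    with eq show False by (smt (verit) zero_le_power2)
  qed
  with eq have "m\<^sup>2 = 2\<^sup>2" by simp
  then have "m = 2 \<or> m = -2"
    by (simp only: power2_eq_iff)
  with mk \<open>k = 0\<close> show ?thesis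
    by (auto simp: complex_eq_iff)
qed

text \<open>Here the equation is \<open>m\<^sup>2 + 7 * k\<^sup>2 = 8\<close>, whose solutions are
  signs, and \<open>m\<close> is the trace of \<open>z\<close>. A trace of this form lets
  \<open>norm_2_orbit\<close> shift a norm by any given integer.\<close>

lemma Zomega_cmod_sq_2:
  assumes "z \<in> Zomega" "(cmod z)\<^sup>2 = 2"
  shows "z + cnj z = 1 \<or> z + cnj z = -1"
proof -
  obtain m k where mk: "2 * Re z = of_int m" "2 * Im z = of_int k * sqrt 7"
    using assms(1) by (rule Zomega_Re_Im)
  have "(2 * Re z)\<^sup>2 + (2 * Im z)\<^sup>2 = 4 * (cmod z)\<^sup>2"
    unfolding cmod_power2 by (simp add: power2_eq_square)
  then have "of_int (m\<^sup>2 + 7 * k\<^sup>2) = (of_int 8 :: real)"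
    unfolding mk assms(2) by (simp add: power_mult_distrib)
  then have eq: "m\<^sup>2 + 7 * k\<^sup>2 = 8"
    by (simp only: of_int_eq_iff)
  have "k \<noteq> 0"
  proof
    assume "k = 0"
    with eq have m: "m\<^sup>2 = 8" by simp
    have "\<bar>m\<bar> < 3"
      using m by (intro power2_less_imp_less[of "\<bar>m\<bar>" 3]) simp_all
    then have "m \<in> {-2,-1,0,1,2}" by auto
    with m show False by auto
  qed
  then have "k\<^sup>2 \<ge> 1"
    by (metis int_one_le_iff_zero_less zero_less_power2)
  moreover have "m\<^sup>2 \<noteq> 0"
  proof
    assume "m\<^sup>2 = 0"
    with eq have "7 * k\<^sup>2 = 8" by simp
    then show False by presburger
  qed
  then have "m\<^sup>2 \<ge> 1"
    by (metis int_one_le_iff_zero_less zero_less_power2 zero_eq_power2)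
  ultimately have "m\<^sup>2 = 1\<^sup>2"
    using eq by simp
  then have "m = 1 \<or> m = -1"
    by (simp only: power2_eq_iff)
  with mk show ?thesis
    by (auto simp: complex_eq_iff)
qed

text \<open>The imaginary part is rounded first, to the nearest row of the lattice; rows are
  \<open>sqrt 7 / 2\<close> apart. Rounding along that row then gives a squared error of at most
  \<open>7 / 16 + 1 / 4\<close>. That this is below 1 makes the ring norm-Euclidean and drives the
  lattice reduction.\<close>

lemma Zomega_approx:
  obtains t where "t \<in> Zomega" "(cmod (z - t))\<^sup>2 \<le> 11 / 16"
proof -
  define k where "k = round (2 * Im z / sqrt 7)"
  define m where "m = round (Re z - of_int k / 2)"
  define t where "t = of_int m + of_int k * omega"
  have "\<bar>of_int k - 2 * Im z / sqrt 7\<bar> \<le> 1 / 2"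
    unfolding k_def by (rule of_int_round_abs_le)
  then have "\<bar>of_int k - 2 * Im z / sqrt 7\<bar> * (sqrt 7 / 2) \<le> 1 / 2 * (sqrt 7 / 2)"
    by (rule mult_right_mono) simp
  moreover have "(of_int k - 2 * Im z / sqrt 7) * (sqrt 7 / 2) = - Im (z - t)"
    by (simp add: t_def field_simps)
  then have "\<bar>of_int k - 2 * Im z / sqrt 7\<bar> * (sqrt 7 / 2) = \<bar>Im (z - t)\<bar>"
    by (metis abs_minus_cancel abs_mult abs_of_nonneg real_sqrt_ge_zero zero_le_divide_iff zero_le_numeral)
  ultimately have "\<bar>Im (z - t)\<bar> \<le> sqrt 7 / 4"
    by linarith
  then have "\<bar>Im (z - t)\<bar>\<^sup>2 \<le> (sqrt 7 / 4)\<^sup>2"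
    by (rule power_mono) simp
  then have 1: "(Im (z - t))\<^sup>2 \<le> 7 / 16"
    by (simp add: power_divide)
  have "\<bar>of_int m - (Re z - of_int k / 2)\<bar> \<le> 1 / 2"
    unfolding m_def by (rule of_int_round_abs_le)
  moreover have "of_int m - (Re z - of_int k / 2) = - Re (z - t)"
    by (simp add: t_def)
  ultimately have "\<bar>Re (z - t)\<bar> \<le> 1 / 2"
    by (metis abs_minus_cancel)
  then have "\<bar>Re (z - t)\<bar>\<^sup>2 \<le> (1 / 2)\<^sup>2"
    by (rule power_mono) simp
  then have 2: "(Re (z - t))\<^sup>2 \<le> 1 / 4"
    by (simp add: power_divide)
  show ?thesis
  proof (rule that)
    show "t \<in> Zomega"
      unfolding t_def by (rule ZomegaI)
    show "(cmod (z - t))\<^sup>2 \<le> 11 / 16"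
      unfolding cmod_power2 using 1 2 by linarith
  qed
qed

lemma Zomega_division:
  assumes "b \<noteq> 0"
  obtains t where "t \<in> Zomega" "(cmod (a - t * b))\<^sup>2 \<le> 11 / 16 * (cmod b)\<^sup>2"
proof -
  obtain t where t: "t \<in> Zomega" "(cmod (a / b - t))\<^sup>2 \<le> 11 / 16"
    by (rule Zomega_approx)
  have "a - t * b = (a / b - t) * b"
    using assms by (simp add: algebra_simps)
  then have "(cmod (a - t * b))\<^sup>2 = (cmod (a / b - t))\<^sup>2 * (cmod b)\<^sup>2"
    by (simp add: norm_mult power_mult_distrib)
  also have "\<dots> \<le> 11 / 16 * (cmod b)\<^sup>2"
    using t(2) by (rule mult_right_mono) simp
  finally show ?thesis
    using that t(1) by blast
qed

text \<open>A vector and the pairing \<open>\<Sum>i. q i * x i\<close> play the roles of a family and a Bezout combination: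
  an element of least modulus of the ideal generated by the entries divides all entries.\<close>

lemma Zomega_primitive_part:
  fixes x :: "complex^'n"
  assumes x: "\<And>i. x $ i \<in> Zomega" "x \<noteq> 0"
  obtains d x' q where "d \<in> Zomega" "d \<noteq> 0" "\<And>i. x' $ i \<in> Zomega" "\<And>i. q $ i \<in> Zomega" "x = d *s x'"
    "(\<Sum>i\<in>UNIV. q $ i * x' $ i) = 1"
proof -
  define I where "I = {(\<Sum>i\<in>UNIV. q $ i * x $ i) | q. \<forall>i. q $ i \<in> Zomega}"
  have I_Z: "I \<subseteq> Zomega"
    unfolding I_def using x(1) by (auto intro!: Zomega_sum Zomega_mult)
  have I_x: "x $ j \<in> I" for j
  proof -
    have "(\<Sum>i\<in>UNIV. axis j 1 $ i * x $ i) = x $ j"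
      by (simp add: axis_def if_distrib[of "\<lambda>y. y * _"] cong: if_cong)
    moreover have "\<forall>i. axis j 1 $ i \<in> Zomega"
      by (simp add: axis_def)
    ultimately show ?thesis
      unfolding I_def by (intro CollectI exI[of _ "axis j 1"]) simp
  qed
  have I_diff: "a - t * b \<in> I" if "a \<in> I" "b \<in> I" "t \<in> Zomega" for a b t
  proof -
    obtain q r where qr: "\<forall>i. q $ i \<in> Zomega" "\<forall>i. r $ i \<in> Zomega"
      "a = (\<Sum>i\<in>UNIV. q $ i * x $ i)" "b = (\<Sum>i\<in>UNIV. r $ i * x $ i)"
      using \<open>a \<in> I\<close> \<open>b \<in> I\<close> unfolding I_def by auto
    have "a - t * b = (\<Sum>i\<in>UNIV. (q - t *s r) $ i * x $ i)"
      by (simp add: qr sum_subtractf sum_distrib_left algebra_simps)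
    moreover have "\<forall>i. (q - t *s r) $ i \<in> Zomega"
      using qr that(3) by auto
    ultimately show ?thesis
      unfolding I_def by blast
  qed
  obtain j where "x $ j \<noteq> 0"
    using x(2) by (auto simp: vec_eq_iff)
  then have ex: "x $ j \<in> I \<and> x $ j \<noteq> 0"
    using I_x by blast
  \<comment> \<open>Squared moduli of ring elements are integers, so the floor loses nothing and
    only provides a measure in the natural numbers.\<close>
  obtain d where d: "d \<in> I" "d \<noteq> 0"
    and d_min: "\<And>e. e \<in> I \<Longrightarrow> e \<noteq> 0 \<Longrightarrow> nat \<lfloor>(cmod d)\<^sup>2\<rfloor> \<le> nat \<lfloor>(cmod e)\<^sup>2\<rfloor>"
    using ex_has_least_nat[of "\<lambda>d. d \<in> I \<and> d \<noteq> 0", OF ex, of "\<lambda>e. nat \<lfloor>(cmod e)\<^sup>2\<rfloor>"] by blast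
  have "\<exists>t\<in>Zomega. x $ i = d * t" for i
  proof -
    obtain t where t: "t \<in> Zomega" "(cmod (x $ i - t * d))\<^sup>2 \<le> 11 / 16 * (cmod d)\<^sup>2"
      using Zomega_division[OF d(2)] by blast
    have e: "x $ i - t * d \<in> I"
      by (intro I_diff I_x d t)
    have "x $ i - t * d = 0"
    proof (rule ccontr)
      assume ne: "x $ i - t * d \<noteq> 0"
      obtain m n where mn: "(cmod d)\<^sup>2 = of_nat m" "(cmod (x $ i - t * d))\<^sup>2 = of_nat n"
        using Zomega_cmod_sq e d(1) I_Z by (metis subsetD)
      have "m \<le> n"
        using d_min[OF e ne] by (simp add: mn)
      moreover have "m > 0"
        using mn(1) d(2) by (cases m) auto
      moreover have "real n \<le> 11 / 16 * real m"
        using t(2) by (simp add: mn)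
      ultimately show False by linarith
    qed
    then show ?thesis
      using t(1) by (intro bexI[of _ t]) (auto simp: mult.commute)
  qed
  then obtain f where f: "\<And>i. f i \<in> Zomega" "\<And>i. x $ i = d * f i"
    by metis
  obtain q where q: "\<forall>i. q $ i \<in> Zomega" "d = (\<Sum>i\<in>UNIV. q $ i * x $ i)"
    using d(1) unfolding I_def by blast
  have "d * (\<Sum>i\<in>UNIV. q $ i * f i) = d * 1"
    unfolding sum_distrib_left using q(2) f(2) by (simp add: mult.left_commute)
  then have "(\<Sum>i\<in>UNIV. q $ i * f i) = 1"
    using d(2) mult_left_cancel by blast
  then show ?thesis
    using that[of d "\<chi> i. f i" q] d I_Z f q(1) by (auto simp: vec_eq_iff)
qed

section \<open>Integral closure: \<open>Zomega\<close> is \<open>O7\<close>\<close>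

text \<open>Rational root theorem: once a common factor is cancelled, \<open>a\<close> and
  \<open>b\<close> satisfy a Bezout relation, while clearing denominators in the monic equation
  makes \<open>b\<close> divide \<open>a ^ n\<close>. Hence \<open>b\<close> is a unit.\<close>

lemma algebraic_int_imp_Zomega:
  assumes z: "algebraic_int z" "x \<in> Zomega" "y \<in> Zomega" "y \<noteq> 0" "z = x / y"
  shows "z \<in> Zomega"
proof -
  define v :: "complex^2" where "v = vector [x, y]"
  have "\<forall>i. v $ i \<in> Zomega"
    using z(2,3) by (simp add: v_def forall_2)
  moreover have "v $ 2 \<noteq> 0"
    using z(4) by (simp add: v_def)
  then have "v \<noteq> 0"
    by auto
  ultimately obtain d x' q where *: "d \<in> Zomega" "d \<noteq> 0" "\<And>i. x' $ i \<in> Zomega" "\<And>i. q $ i \<in> Zomega"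
    "v = d *s x'" "(\<Sum>i\<in>UNIV. q $ i * x' $ i) = 1"
    using Zomega_primitive_part[of v] by blast
  define a b where "a = x' $ 1" and "b = x' $ 2"
  have xy: "x = d * a" "y = d * b"
    using arg_cong[OF *(5), of "\<lambda>v. v $ 1"] arg_cong[OF *(5), of "\<lambda>v. v $ 2"]
    by (simp_all add: v_def a_def b_def)
  have ab: "a \<in> Zomega" "b \<in> Zomega" "b \<noteq> 0" "z = a / b"
    using * xy z(4,5) by (auto simp: a_def b_def)
  have bez: "q $ 1 * a + q $ 2 * b = 1"
    using *(6) by (simp add: sum_2 a_def b_def)
  obtain p where p: "lead_coeff p = 1" "\<forall>i. Polynomial.coeff p i \<in> \<int>" "poly p z = 0"
    using z(1) by (auto simp: algebraic_int.simps)
  define n where "n = degree p"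
  have "0 = b ^ n * poly p z"
    using p by simp
  also have "\<dots> = (\<Sum>i\<le>n. Polynomial.coeff p i * (b ^ n * z ^ i))"
    by (simp add: poly_altdef n_def sum_distrib_left mult_ac)
  also have "\<dots> = (\<Sum>i\<le>n. Polynomial.coeff p i * (a ^ i * b ^ (n - i)))"
  proof (intro sum.cong refl)
    fix i assume "i \<in> {..n}"
    then have "b ^ n = b ^ i * b ^ (n - i)"
      by (simp flip: power_add)
    then show "Polynomial.coeff p i * (b ^ n * z ^ i) = Polynomial.coeff p i * (a ^ i * b ^ (n - i))"
      using ab(3,4) by (simp add: power_divide)
  qed
  \<comment> \<open>The polynomial is monic, so the top term is \<open>a ^ n\<close> itself; every
    other term contains a factor \<open>b\<close>.\<close>
  also have "\<dots> = (\<Sum>i<n. Polynomial.coeff p i * (a ^ i * b ^ (n - i))) + a ^ n"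
    using p(1) by (simp add: n_def flip: lessThan_Suc_atMost)
  also have "(\<Sum>i<n. Polynomial.coeff p i * (a ^ i * b ^ (n - i))) = b * (\<Sum>i<n. Polynomial.coeff p i * (a ^ i * b ^ (n - i - 1)))"
    unfolding sum_distrib_left
  proof (intro sum.cong refl)
    fix i assume "i \<in> {..<n}"
    then have "b ^ (n - i) = b * b ^ (n - i - 1)"
      by (simp flip: power_Suc add: Suc_diff_Suc)
    then show "Polynomial.coeff p i * (a ^ i * b ^ (n - i)) = b * (Polynomial.coeff p i * (a ^ i * b ^ (n - i - 1)))"
      by simp
  qed
  finally have "a ^ n = b * - (\<Sum>i<n. Polynomial.coeff p i * (a ^ i * b ^ (n - i - 1)))"
    by (simp add: eq_neg_iff_add_eq_0 add.commute)
  moreover have "(\<Sum>i<n. Polynomial.coeff p i * (a ^ i * b ^ (n - i - 1))) \<in> Zomega"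
    using p(2) ab by (intro Zomega_sum Zomega_mult Zomega_power) (metis Ints_cases Zomega_of_int)+
  ultimately obtain s where s: "a ^ n = b * s" "s \<in> Zomega"
    by blast
  \<comment> \<open>Powers of the Bezout relation: \<open>a ^ k\<close> is invertible modulo
    \<open>b\<close>. For \<open>k = n\<close>, together with \<open>a ^ n = b * s\<close>, this
    exhibits an inverse of \<open>b\<close>.\<close>
  have pw: "\<exists>t\<in>Zomega. 1 = q $ 1 ^ k * a ^ k + b * t" for k
  proof (induction k)
    case 0
    show ?case by (intro bexI[of _ 0]) auto
  next
    case (Suc k)
    then obtain t where t: "t \<in> Zomega" "1 = q $ 1 ^ k * a ^ k + b * t" by blast
    have "1 = (q $ 1 ^ k * a ^ k) * (q $ 1 * a + q $ 2 * b) + b * t"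
      using t(2) bez by simp
    then have "1 = q $ 1 ^ Suc k * a ^ Suc k + b * (q $ 1 ^ k * a ^ k * q $ 2 + t)"
      by (simp add: algebra_simps)
    moreover have "q $ 1 ^ k * a ^ k * q $ 2 + t \<in> Zomega"
      using *(4) ab t by (intro Zomega_add Zomega_mult Zomega_power)
    ultimately show ?case by blast
  qed
  obtain t where t: "t \<in> Zomega" "1 = q $ 1 ^ n * a ^ n + b * t"
    using pw by blast
  then have "1 = b * (q $ 1 ^ n * s + t)"
    by (simp add: s algebra_simps)
  then have "z = z * b * (q $ 1 ^ n * s + t)"
    by (simp add: mult.assoc)
  then have "z = a * (q $ 1 ^ n * s + t)"
    using ab(3,4) by simp
  then show ?thesis
    using *(4) ab(1,2) s(2) t(1) by (simp add: Zomega_add Zomega_mult Zomega_power)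
qed

lemma Zomega_imp_algebraic_int:
  assumes "z \<in> Zomega"
  shows "algebraic_int z"
proof -
  obtain m k where z: "z = of_int m + of_int k * omega"
    using assms by (elim ZomegaE)
  \<comment> \<open>The monic quadratic with roots \<open>z\<close> and \<open>cnj z\<close>,
    written through their sum \<open>2 * m + k\<close> and their product.\<close>
  define p :: "complex poly" where
    "p = [:of_int (m * m + m * k + 2 * k * k), - of_int (2 * m + k), 1:]"
  have "poly p z = of_int k * of_int k * (omega * omega - omega + 2)"
    unfolding p_def z by (simp add: algebra_simps)
  then have "poly p z = 0"
    unfolding omega_sq by simp
  moreover have "lead_coeff p = 1"
    by (simp add: p_def)
  moreover have "\<forall>i. Polynomial.coeff p i \<in> \<int>"
    unfolding p_def by (auto simp: coeff_pCons split: nat.splits)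
  ultimately show ?thesis
    by (auto simp: algebraic_int.simps)
qed

lemma Q_sqrt_minus7_fraction:
  assumes "z \<in> Q_sqrt_minus7"
  obtains x y where "x \<in> Zomega" "y \<in> Zomega" "y \<noteq> 0" "z = x / y"
proof -
  obtain a b where ab: "a \<in> \<rat>" "b \<in> \<rat>" "z = a + b * (\<i> * of_real (sqrt 7))"
    using assms unfolding Q_sqrt_minus7_def by blast
  obtain a1 a2 :: int where a: "a2 > 0" "a = of_int a1 / of_int a2"
    using ab(1) by (elim Rats_cases') auto
  obtain b1 b2 :: int where b: "b2 > 0" "b = of_int b1 / of_int b2"
    using ab(2) by (elim Rats_cases') auto
  have s: "\<i> * of_real (sqrt 7) = 2 * omega - 1"
    by (simp add: omega_def add_divide_distrib)
  have "z = (of_int a1 * of_int b2 + of_int b1 * of_int a2 * (2 * omega - 1)) / (of_int a2 * of_int b2)"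
    unfolding ab(3) s a(2) b(2) using a(1) b(1) by (simp add: field_simps)
  then show ?thesis
    using a(1) b(1) by (elim that[rotated 3]) (auto intro!: Zomega_add Zomega_mult Zomega_diff)
qed

lemma fraction_Q_sqrt_minus7:
  assumes "x \<in> Zomega" "y \<in> Zomega"
  shows "x / y \<in> Q_sqrt_minus7"
proof -
  obtain n where n: "(cmod y)\<^sup>2 = real n"
    using Zomega_cmod_sq[OF assms(2)] by blast
  have "x * cnj y \<in> Zomega"
    using assms by auto
  then obtain m k where mk: "x * cnj y = of_int m + of_int k * omega"
    by (elim ZomegaE)
  \<comment> \<open>For \<open>y = 0\<close> both sides are 0, by the convention for division by
    0.\<close>
  have "x / y = x * cnj y / of_nat n"
    using n by (simp add: complex_div_cnj[of x y])
  also have "\<dots> = (of_int m / of_nat n + of_int k / (2 * of_nat n))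
      + of_int k / (2 * of_nat n) * (\<i> * of_real (sqrt 7))"
    unfolding mk by (simp add: omega_def add_divide_distrib distrib_left)
  finally show ?thesis
    unfolding Q_sqrt_minus7_def
    by (intro CollectI exI[of _ "of_int m / of_nat n + of_int k / (2 * of_nat n)"]
        exI[of _ "of_int k / (2 * of_nat n)"] conjI) auto
qed

lemma Q_sqrt_minus7_algebraic_int:
  "z \<in> Zomega" if "z \<in> Q_sqrt_minus7" "algebraic_int z"
  using that Q_sqrt_minus7_fraction algebraic_int_imp_Zomega by metis

lemma O7_eq_Zomega: "O7 = Zomega"
  unfolding O7_def
  using Q_sqrt_minus7_algebraic_int Zomega_imp_algebraic_int fraction_Q_sqrt_minus7[of _ 1]
  by auto

section \<open>The group and its action on integral vectors\<close>

lemma herm_add_left: "herm (x + y) z = herm x z + herm y z"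
  and herm_add_right: "herm z (x + y) = herm z x + herm z y"
  and herm_diff_left: "herm (x - y) z = herm x z - herm y z"
  and herm_diff_right: "herm z (x - y) = herm z x - herm z y"
  and herm_scale_left: "herm (c *s x) z = c * herm x z"
  and herm_scale_right: "herm z (c *s x) = cnj c * herm z x"
  and herm_minus_left: "herm (- x) z = - herm x z"
  and herm_minus_right: "herm z (- x) = - herm z x"
  by (simp_all add: herm_expand algebra_simps)

lemmas herm_linear = herm_add_left herm_add_right herm_diff_left herm_diff_right
  herm_scale_left herm_scale_right herm_minus_left herm_minus_right

lemma herm_0 [simp]: "herm 0 x = 0" "herm x 0 = 0"
  by (simp_all add: herm_expand)

lemma herm_commute: "herm x y = cnj (herm y x)"
  by (simp add: herm_expand)

lemma cnj_herm_self [simp]: "cnj (herm x x) = herm x x"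
  by (metis herm_commute)

lemma herm_scale_self: "Re (herm (c *s x) (c *s x)) = (cmod c)\<^sup>2 * Re (herm x x)"
proof -
  have "herm (c *s x) (c *s x) = of_real ((cmod c)\<^sup>2) * herm x x"
    unfolding complex_norm_square by (simp add: herm_linear mult_ac)
  then show ?thesis
    by (simp only: times_complex.sel Re_complex_of_real Im_complex_of_real)
qed

lemma herm_nondegenerate:
  assumes "\<And>w. herm x w = herm y w"
  shows "x = y"
  using assms[of "vector [1, 0, 0]"] assms[of "vector [0, 1, 0]"] assms[of "vector [0, 0, 1]"]
  by (simp add: herm_expand vec_eq_iff forall_3)

section \<open>Integral vectors and integral isometries\<close>

definition integral_vecs :: "(complex^3) set" where
  "integral_vecs = {x. \<forall>i. x $ i \<in> Zomega}"

lemma integral_vecs_add [intro]: "x \<in> integral_vecs \<Longrightarrow> y \<in> integral_vecs \<Longrightarrow> x + y \<in> integral_vecs"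
  and integral_vecs_diff [intro]: "x \<in> integral_vecs \<Longrightarrow> y \<in> integral_vecs \<Longrightarrow> x - y \<in> integral_vecs"
  and integral_vecs_minus [intro]: "x \<in> integral_vecs \<Longrightarrow> - x \<in> integral_vecs"
  and integral_vecs_scale [intro]: "c \<in> Zomega \<Longrightarrow> x \<in> integral_vecs \<Longrightarrow> c *s x \<in> integral_vecs"
  by (auto simp: integral_vecs_def)

lemma integral_vecs_nth [intro]: "x \<in> integral_vecs \<Longrightarrow> x $ i \<in> Zomega"
  by (simp add: integral_vecs_def)

lemma integral_vecs_vector [intro]:
  "a \<in> Zomega \<Longrightarrow> b \<in> Zomega \<Longrightarrow> c \<in> Zomega \<Longrightarrow> vector [a, b, c] \<in> integral_vecs"
  by (simp add: integral_vecs_def forall_3)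

lemma herm_Zomega [intro]: "x \<in> integral_vecs \<Longrightarrow> y \<in> integral_vecs \<Longrightarrow> herm x y \<in> Zomega"
  unfolding herm_expand by (intro Zomega_add Zomega_mult Zomega_cnj integral_vecs_nth)

lemma herm_self_int:
  assumes "x \<in> integral_vecs"
  obtains m :: int where "herm x x = of_int m"
  using Zomega_real[OF herm_Zomega[OF assms assms] herm_self_real] by blast

definition cols :: "complex^3 \<Rightarrow> complex^3 \<Rightarrow> complex^3 \<Rightarrow> complex^3^3" where
  "cols a b c = (\<chi> i. vector [a $ i, b $ i, c $ i])"

lemma cols_mult_vec: "cols a b c *v x = x $ 1 *s a + x $ 2 *s b + x $ 3 *s c"
  by (simp add: cols_def matrix_vector_mult_def vec_eq_iff sum_3 mult.commute)

text \<open>The standard basis has Gram matrix \<open>J\<close>, and a linear map that carries it to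
  a triple with the same Gram matrix preserves the form. The three products not listed follow by
  conjugation.\<close>

lemma cols_UJ:
  assumes "herm a a = 0" "herm c c = 0" "herm b b = 1" "herm a b = 0" "herm a c = 1" "herm b c = 0"
  shows "cols a b c \<in> UJ"
proof -
  have "herm b a = 0" "herm c a = 1" "herm c b = 0"
    using assms herm_commute by (metis complex_cnj_zero complex_cnj_one)+
  then have "herm (cols a b c *v v) (cols a b c *v w) = herm v w" for v w
    unfolding cols_mult_vec herm_expand[of v w] by (simp add: herm_linear assms algebra_simps)
  then show ?thesis
    by (simp add: UJ_def)
qed

text \<open>This is \<open>J\<close> times the conjugate transpose of \<open>A\<close> times
  \<open>J\<close>, the adjoint with respect to \<open>herm\<close>. Its entries are conjugates of
  entries of \<open>A\<close>, so the inverse of an integral isometry is visibly integral.\<close>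

definition adj :: "complex^3^3 \<Rightarrow> complex^3^3" where
  "adj A = vector [vector [cnj (A $ 3 $ 3), cnj (A $ 2 $ 3), cnj (A $ 1 $ 3)],
                   vector [cnj (A $ 3 $ 2), cnj (A $ 2 $ 2), cnj (A $ 1 $ 2)],
                   vector [cnj (A $ 3 $ 1), cnj (A $ 2 $ 1), cnj (A $ 1 $ 1)]]"

lemma herm_adj: "herm (adj A *v x) y = herm x (A *v y)"
  by (simp add: herm_expand adj_def matrix_vector_mult_def sum_3 algebra_simps)

lemma UJ_herm: "A \<in> UJ \<Longrightarrow> herm (A *v x) (A *v y) = herm x y"
  by (simp add: UJ_def)

lemma adj_mult:
  assumes "A \<in> UJ"
  shows "adj A ** A = mat 1" "A ** adj A = mat 1"
proof -
  have "adj A *v (A *v x) = x" for x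
    by (rule herm_nondegenerate) (simp add: herm_adj UJ_herm[OF assms])
  then show "adj A ** A = mat 1"
    by (subst matrix_eq) (simp add: matrix_vector_mul_assoc [symmetric])
  then show "A ** adj A = mat 1"
    by (rule matrix_left_right_inverse1)
qed

lemma UJ_adj_mult_vec:
  assumes "A \<in> UJ"
  shows "adj A *v (A *v x) = x" "A *v (adj A *v x) = x"
  by (simp_all add: matrix_vector_mul_assoc adj_mult[OF assms])

lemma UJ_mult: "A \<in> UJ \<Longrightarrow> B \<in> UJ \<Longrightarrow> A ** B \<in> UJ"
  by (simp add: UJ_def matrix_vector_mul_assoc [symmetric])

lemma UJ_adj: "A \<in> UJ \<Longrightarrow> adj A \<in> UJ"
  by (simp add: UJ_def herm_adj UJ_adj_mult_vec(2) UJ_def)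

definition integral_UJ :: "(complex^3^3) set" where
  "integral_UJ = {A \<in> UJ. \<forall>i j. A $ i $ j \<in> Zomega}"

lemma integral_UJ_imp_UJ: "A \<in> integral_UJ \<Longrightarrow> A \<in> UJ"
  by (simp add: integral_UJ_def)

lemma integral_UJ_adj: "A \<in> integral_UJ \<Longrightarrow> adj A \<in> integral_UJ"
  by (simp add: integral_UJ_def UJ_adj) (simp add: adj_def forall_3 Zomega_cnj)

lemma integral_UJ_mult: "A \<in> integral_UJ \<Longrightarrow> B \<in> integral_UJ \<Longrightarrow> A ** B \<in> integral_UJ"
  by (simp add: integral_UJ_def UJ_mult) (simp add: matrix_matrix_mult_def Zomega_sum Zomega_mult)

lemma integral_UJ_mult_vec: "A \<in> integral_UJ \<Longrightarrow> x \<in> integral_vecs \<Longrightarrow> A *v x \<in> integral_vecs"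
  by (auto simp: integral_UJ_def integral_vecs_def matrix_vector_mult_def intro!: Zomega_sum Zomega_mult)

lemma cols_integral_UJ:
  assumes "a \<in> integral_vecs" "b \<in> integral_vecs" "c \<in> integral_vecs" "cols a b c \<in> UJ"
  shows "cols a b c \<in> integral_UJ"
  using assms by (auto simp: integral_UJ_def cols_def forall_3 integral_vecs_def)

text \<open>The inverse of an integral isometry is \<open>adj A\<close>, which supplies the integral
  inverse demanded by \<open>GL3_O7\<close>.\<close>

lemma carrier_UJ_O7: "carrier UJ_O7 = integral_UJ"
proof -
  have "A \<in> GL3_O7" if "A \<in> integral_UJ" for A
    using that integral_UJ_adj[OF that] adj_mult[of A]
    unfolding GL3_O7_def O7_eq_Zomega integral_UJ_def by blast
  then show ?thesis
    by (auto simp: UJ_O7_def integral_UJ_def GL3_O7_def O7_eq_Zomega)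
qed

lemma mult_UJ_O7 [simp]: "A \<otimes>\<^bsub>UJ_O7\<^esub> B = A ** B" and one_UJ_O7 [simp]: "\<one>\<^bsub>UJ_O7\<^esub> = mat 1"
  by (simp_all add: UJ_O7_def)

lemma mat_1_integral_UJ: "mat 1 \<in> integral_UJ"
  by (simp add: integral_UJ_def UJ_def) (simp add: mat_def)

lemma minus_mult_vec: "(- A) *v x = - (A *v x)" for A :: "complex^3^3"
  by (simp add: matrix_vector_mult_def vec_eq_iff sum_negf)

lemma mult_minus_mat: "A ** (- B) = - (A ** B)" "(- A) ** B = - (A ** B)" for A :: "complex^3^3"
  by (simp_all add: matrix_matrix_mult_def vec_eq_iff sum_negf)

lemma minus_integral_UJ: "A \<in> integral_UJ \<Longrightarrow> - A \<in> integral_UJ"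
  by (auto simp: integral_UJ_def UJ_def minus_mult_vec herm_linear)

section \<open>The quotient by signs and its conjugacy classes\<close>

lemma group_UJ_O7: "group UJ_O7"
proof (rule groupI)
  fix A assume "A \<in> carrier UJ_O7"
  then show "\<exists>B\<in>carrier UJ_O7. B \<otimes>\<^bsub>UJ_O7\<^esub> A = \<one>\<^bsub>UJ_O7\<^esub>"
    by (intro bexI[of _ "adj A"])
       (simp_all add: carrier_UJ_O7 integral_UJ_adj adj_mult integral_UJ_imp_UJ)
qed (auto simp: carrier_UJ_O7 integral_UJ_mult mat_1_integral_UJ matrix_mul_assoc)

interpretation UJ_O7: group UJ_O7
  by (rule group_UJ_O7)

lemma normal_sign: "{mat 1, - mat 1} \<lhd> UJ_O7"
  unfolding UJ_O7.normal_inv_iff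
proof (intro conjI ballI)
  show "subgroup {mat 1, - mat 1} UJ_O7"
    by (rule UJ_O7.subgroupI)
      (auto simp: carrier_UJ_O7 mat_1_integral_UJ minus_integral_UJ mult_minus_mat
        intro!: UJ_O7.inv_equality)
next
  fix A h :: "complex^3^3" assume A: "A \<in> carrier UJ_O7" and h: "h \<in> {mat 1, - mat 1}"
  have "A ** inv\<^bsub>UJ_O7\<^esub> A = mat 1"
    using UJ_O7.r_inv[OF A] by simp
  with h show "A \<otimes>\<^bsub>UJ_O7\<^esub> h \<otimes>\<^bsub>UJ_O7\<^esub> inv\<^bsub>UJ_O7\<^esub> A \<in> {mat 1, - mat 1}"
    by (auto simp: mult_minus_mat)
qed

interpretation sign: normal "{mat 1, - mat 1}" UJ_O7
  by (rule normal_sign)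

lemma group_PU: "group PU_J_O7"
  unfolding PU_J_O7_def by (rule sign.factorgroup_is_group)

interpretation PU: group PU_J_O7
  by (rule group_PU)

lemma carrier_PU: "carrier PU_J_O7 = pclass ` integral_UJ"
  unfolding PU_J_O7_def carrier_FactGroup carrier_UJ_O7 pclass_def ..

lemma one_PU: "\<one>\<^bsub>PU_J_O7\<^esub> = pclass (mat 1)"
  by (simp add: PU_J_O7_def pclass_eq)

lemma mult_PU: "A \<in> integral_UJ \<Longrightarrow> B \<in> integral_UJ \<Longrightarrow> pclass A \<otimes>\<^bsub>PU_J_O7\<^esub> pclass B = pclass (A ** B)"
  unfolding PU_J_O7_def mult_FactGroup pclass_def by (simp add: sign.rcos_sum carrier_UJ_O7)

lemma inv_PU: "A \<in> integral_UJ \<Longrightarrow> inv\<^bsub>PU_J_O7\<^esub> pclass A = pclass (adj A)"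
  by (rule PU.inv_equality)
    (simp_all add: mult_PU integral_UJ_adj adj_mult one_PU carrier_PU integral_UJ_imp_UJ)

lemma pclass_eq_iff: "pclass A = pclass B \<longleftrightarrow> A = B \<or> A = - B"
  unfolding pclass_eq by (auto simp: doubleton_eq_iff)

lemma conj_class_conjugate:
  assumes "group G" "h \<in> carrier G" "g \<in> carrier G"
  shows "conj_class G (h \<otimes>\<^bsub>G\<^esub> g \<otimes>\<^bsub>G\<^esub> inv\<^bsub>G\<^esub> h) = conj_class G g"
proof -
  interpret group G by fact
  have eq: "k \<otimes>\<^bsub>G\<^esub> (h \<otimes>\<^bsub>G\<^esub> g \<otimes>\<^bsub>G\<^esub> inv\<^bsub>G\<^esub> h) \<otimes>\<^bsub>G\<^esub> inv\<^bsub>G\<^esub> k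
      = (k \<otimes>\<^bsub>G\<^esub> h) \<otimes>\<^bsub>G\<^esub> g \<otimes>\<^bsub>G\<^esub> inv\<^bsub>G\<^esub> (k \<otimes>\<^bsub>G\<^esub> h)" if "k \<in> carrier G" for k
    using that assms by (simp add: inv_mult_group m_assoc)
  \<comment> \<open>Right translation by \<open>h\<close> is onto, so conjugating by
    \<open>k\<close> is the same as conjugating the conjugate by some \<open>k'\<close>; this gives
    the reverse inclusion.\<close>
  have "\<exists>k'\<in>carrier G. k = k' \<otimes>\<^bsub>G\<^esub> h" if "k \<in> carrier G" for k
    by (rule bexI[of _ "k \<otimes>\<^bsub>G\<^esub> inv\<^bsub>G\<^esub> h"]) (use that assms in \<open>simp_all add: m_assoc\<close>)
  then show ?thesis
    using assms by (auto simp: conj_class_def orbit_def eq) (metis eq m_closed)+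
qed

lemma conj_class_eqD:
  assumes "group G" "g \<in> carrier G" "g' \<in> carrier G" "conj_class G g = conj_class G g'"
  obtains h where "h \<in> carrier G" "g' = h \<otimes>\<^bsub>G\<^esub> g \<otimes>\<^bsub>G\<^esub> inv\<^bsub>G\<^esub> h"
proof -
  interpret group G by fact
  have "g' \<in> conj_class G g'"
    unfolding conj_class_def orbit_def using assms by (auto intro!: exI[of _ "\<one>\<^bsub>G\<^esub>"])
  then show ?thesis
    using that assms by (auto simp flip: assms(4) simp: conj_class_def orbit_def)
qed

section \<open>Orbits of vectors of norm 1 and 2\<close>

text \<open>Since \<open>J\<close> merely permutes coordinates, an integral \<open>q\<close> with
  \<open>herm x q = 1\<close> is a Bezout relation between the entries of \<open>x\<close>. In this
  form primitivity is preserved by integral isometries.\<close>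

definition primitive :: "complex^3 \<Rightarrow> bool" where
  "primitive x \<longleftrightarrow> x \<in> integral_vecs \<and> (\<exists>q\<in>integral_vecs. herm x q = 1)"

lemma primitive_part:
  assumes "x \<in> integral_vecs" "x \<noteq> 0"
  obtains d x' where "d \<in> Zomega" "d \<noteq> 0" "primitive x'" "x = d *s x'"
proof -
  obtain d x' q where *: "d \<in> Zomega" "d \<noteq> 0" "\<And>i. x' $ i \<in> Zomega" "\<And>i. q $ i \<in> Zomega"
    "x = d *s x'" "(\<Sum>i\<in>UNIV. q $ i * x' $ i) = 1"
    using Zomega_primitive_part[of x] assms unfolding integral_vecs_def by blast
  \<comment> \<open>The form pairs the first coordinate with the third and conjugates its second
    argument, so the Bezout coefficients appear reversed and conjugated.\<close>
  have "herm x' (vector [cnj (q $ 3), cnj (q $ 2), cnj (q $ 1)]) = 1"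
    using *(6) by (simp add: herm_expand sum_3 algebra_simps)
  moreover have "vector [cnj (q $ 3), cnj (q $ 2), cnj (q $ 1)] \<in> integral_vecs"
    using *(4) by (intro integral_vecs_vector Zomega_cnj)
  moreover have "x' \<in> integral_vecs"
    using *(3) by (simp add: integral_vecs_def)
  ultimately show ?thesis
    using that * unfolding primitive_def by blast
qed

text \<open>\<open>hcross x y\<close> is \<open>J\<close> applied to the conjugate of the cross product of \<open>x\<close> and \<open>y\<close>, so that
  \<open>herm z (hcross x y)\<close> is the determinant of \<open>x\<close>, \<open>y\<close>, \<open>z\<close>.\<close>

definition hcross :: "complex^3 \<Rightarrow> complex^3 \<Rightarrow> complex^3" where
  "hcross x y = vector [cnj (x $ 1 * y $ 2 - x $ 2 * y $ 1),
                        cnj (x $ 3 * y $ 1 - x $ 1 * y $ 3),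
                        cnj (x $ 2 * y $ 3 - x $ 3 * y $ 2)]"

lemma herm_hcross [simp]: "herm (hcross x y) x = 0" "herm (hcross x y) y = 0"
  by (simp_all add: hcross_def herm_expand algebra_simps)

text \<open>The double cross product formula, used to find a second vector whose cross product with
  a given primitive vector is prescribed.\<close>

lemma hcross_hcross: "hcross w (hcross x y) = herm x w *s y - herm y w *s x"
  by (simp add: hcross_def herm_expand vec_eq_iff forall_3 algebra_simps)

lemma hcross_self [simp]: "hcross x x = 0"
  by (simp add: hcross_def vec_eq_iff forall_3)

lemma hcross_linear: "hcross x (y + c *s z) = hcross x y + cnj c *s hcross x z"
  by (simp add: hcross_def vec_eq_iff forall_3 algebra_simps)

text \<open>Lagrange's identity. The right side is minus the Gram determinant of \<open>x\<close>
  and \<open>y\<close>, the sign being that of the determinant of \<open>J\<close>.\<close>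

lemma herm_hcross_hcross:
  "herm (hcross x y) (hcross x y) = herm x y * herm y x - herm x x * herm y y"
  by (simp add: hcross_def herm_expand algebra_simps)

lemma hcross_integral [intro]: "x \<in> integral_vecs \<Longrightarrow> y \<in> integral_vecs \<Longrightarrow> hcross x y \<in> integral_vecs"
  unfolding hcross_def
  by (intro integral_vecs_vector Zomega_cnj Zomega_diff Zomega_mult integral_vecs_nth)

text \<open>Hermite reduction of the rank two lattice orthogonal to \<open>v\<close>, whose Gram determinant is \<open>- n\<close>.\<close>

lemma orthogonal_lattice_reduced_basis:
  assumes v: "v \<in> integral_vecs" "herm v v = of_int n" and n: "n \<in> {1, 2}"
  obtains x y where "x \<in> integral_vecs" "y \<in> integral_vecs" "herm x v = 0" "herm y v = 0"
    "herm x x = 0 \<and> (cmod (herm x y))\<^sup>2 = n \<or>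
     herm x y = 0 \<and> (herm x x = 1 \<and> herm y y = - n \<or> herm x x = -1 \<and> herm y y = n)"
proof -
  define M where "M = {x \<in> integral_vecs. herm x v = 0 \<and> x \<noteq> 0}"
  define N where "N x = nat \<lfloor>cmod (herm x x)\<rfloor>" for x
  have v0: "v \<noteq> 0"
    using v n by auto
  have "\<exists>e\<in>integral_vecs. hcross v e \<noteq> 0"
  proof (rule ccontr)
    assume "\<not> ?thesis"
    then have "\<And>a b c. a \<in> Zomega \<Longrightarrow> b \<in> Zomega \<Longrightarrow> c \<in> Zomega \<Longrightarrow> hcross v (vector [a, b, c]) = 0"
      using integral_vecs_vector by blast
    from this[of 1 0 0] this[of 0 1 0] have "v = 0"
      by (simp add: hcross_def vec_eq_iff forall_3)
    with v0 show False ..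
  qed
  then obtain e where "e \<in> integral_vecs" "hcross v e \<noteq> 0" by blast
  then have ex: "hcross v e \<in> M"
    unfolding M_def using v by auto
  obtain x0 where x0: "x0 \<in> M" and x0_min: "\<And>z. z \<in> M \<Longrightarrow> N x0 \<le> N z"
    using ex_has_least_nat[of "\<lambda>x. x \<in> M", OF ex, of N] by blast
  have N_int: "real (N z) = cmod (herm z z)" if z: "z \<in> integral_vecs" for z
  proof -
    obtain m where "herm z z = of_int m"
      using herm_self_int[OF z] .
    then show ?thesis
      by (simp add: N_def flip: of_int_abs)
  qed
  \<comment> \<open>Dividing \<open>x0\<close> by its content does not increase the norm in absolute
    value, so the minimal vector may be taken primitive.\<close>
  obtain d x where d: "d \<in> Zomega" "d \<noteq> 0" "primitive x" "x0 = d *s x"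
    using primitive_part[of x0] x0 unfolding M_def by blast
  have x: "x \<in> M"
    using x0 d unfolding M_def primitive_def by (auto simp: herm_linear)
  have "N x \<le> N x0"
  proof -
    obtain k where k: "(cmod d)\<^sup>2 = of_nat k"
      using Zomega_cmod_sq[OF d(1)] .
    with d(2) have "k \<ge> 1"
      by (cases k) auto
    have "real (N x0) = k * real (N x)"
      using x x0 d(4) k[symmetric] by (simp add: M_def N_int herm_linear norm_mult power2_eq_square)
    with \<open>k \<ge> 1\<close> show ?thesis
      by (metis mult_le_mono1 nat_mult_1 of_nat_eq_iff of_nat_mult)
  qed
  with x0_min have x_min: "N x \<le> N z" if "z \<in> M" for z
    using that le_trans by blast
  obtain q where q: "q \<in> integral_vecs" "herm x q = 1"
    using d(3) unfolding primitive_def by blast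
  \<comment> \<open>By the double cross product formula \<open>hcross x y0\<close> is
    \<open>herm q x *s v - herm v x *s q\<close>, that is, \<open>v\<close>. This fixes the Gram
    determinant of \<open>x\<close> and \<open>y0\<close> as minus \<open>n\<close>.\<close>
  define y0 where "y0 = hcross q v"
  have xM: "x \<in> integral_vecs" "herm x v = 0"
    using x by (simp_all add: M_def)
  have "herm v x = 0" "herm q x = 1"
    using xM q herm_commute by (metis complex_cnj_zero complex_cnj_one)+
  then have xy0: "hcross x y0 = v"
    unfolding y0_def hcross_hcross by simp
  have y0: "y0 \<in> integral_vecs" "herm y0 v = 0"
    unfolding y0_def using q v by auto
  have gram: "herm x y * herm y x - herm x x * herm y y = of_int n" if "hcross x y = v" for y
    using herm_hcross_hcross[of x y] that v by simp
  have cmod_gram: "(cmod (herm x y))\<^sup>2 - Re (herm x x) * Re (herm y y) = of_int n" if "hcross x y = v" for y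
  proof -
    have "herm x y * herm y x = of_real ((cmod (herm x y))\<^sup>2)"
      by (subst (2) herm_commute) (rule complex_norm_square [symmetric])
    then have "of_real ((cmod (herm x y))\<^sup>2) - herm x x * herm y y = of_int n"
      using gram[OF that] by simp
    then have "Re (of_real ((cmod (herm x y))\<^sup>2) - herm x x * herm y y) = Re (of_int n)"
      by (rule arg_cong)
    moreover have "Im (herm x x) = 0"
      using herm_self_real[of x] by (simp add: complex_is_Real_iff)
    ultimately show ?thesis
      by simp
  qed
  show ?thesis
  proof (cases "herm x x = 0")
    case True
    then show ?thesis
      using that[OF xM(1) y0(1) xM(2) y0(2)] cmod_gram[OF xy0] by simp
  next
    case False
    \<comment> \<open>Subtracting a multiple of \<open>x\<close> keeps the cross product and makes
      the mixed product small compared with \<open>herm x x\<close>.\<close>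
    obtain t where t: "t \<in> Zomega"
      "(cmod (herm y0 x - t * herm x x))\<^sup>2 \<le> 11 / 16 * (cmod (herm x x))\<^sup>2"
      using Zomega_division[OF False] .
    define y where "y = y0 + (- t) *s x"
    have y: "y \<in> integral_vecs" "herm y v = 0" "hcross x y = v"
      unfolding y_def hcross_linear using xM y0 t xy0 by (auto simp: herm_linear)
    have "herm y x = herm y0 x - t * herm x x"
      by (simp add: y_def herm_linear)
    moreover have "cmod (herm x y) = cmod (herm y x)"
      by (metis complex_mod_cnj herm_commute)
    ultimately have b: "(cmod (herm x y))\<^sup>2 \<le> 11 / 16 * (cmod (herm x x))\<^sup>2"
      using t(2) by simp
    have "y \<noteq> 0"
      using y(3) v0 by (auto simp: hcross_def vec_eq_iff forall_3)
    then have "y \<in> M"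
      using y by (simp add: M_def)
    then have "N x \<le> N y"
      by (rule x_min)
    then have ac: "cmod (herm x x) \<le> cmod (herm y y)"
      using N_int[OF xM(1)] N_int[OF y(1)] by linarith
    obtain a c where a: "herm x x = of_int a" and c: "herm y y = of_int c"
      using herm_self_int xM(1) y(1) by metis
    obtain k where k: "(cmod (herm x y))\<^sup>2 = real k"
      using Zomega_cmod_sq[OF herm_Zomega[OF xM(1) y(1)]] .
    have "real_of_int (int k - a * c) = real_of_int n"
      using cmod_gram[OF y(3)] by (simp add: k a c)
    then have eq: "int k - a * c = n"
      by (simp only: of_int_eq_iff)
    have "real_of_int \<bar>a\<bar> \<le> real_of_int \<bar>c\<bar>"
      using ac by (simp add: a c)
    then have ac': "\<bar>a\<bar> \<le> \<bar>c\<bar>"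
      by linarith
    have "16 * real k \<le> 11 * (real_of_int a)\<^sup>2"
      using b by (simp add: k a)
    also have "\<dots> = real_of_int (11 * (a * a))"
      by (simp add: power2_eq_square)
    finally have k_le: "16 * int k \<le> 11 * (a * a)"
      by linarith
    have a0: "a \<noteq> 0"
      using False a by auto
    have aa: "a * a \<le> \<bar>a * c\<bar>"
      using mult_left_mono[OF ac', of "\<bar>a\<bar>"] by (simp add: abs_mult)
    have "a * a > 0"
      using a0 by (auto simp: zero_less_mult_iff)
    \<comment> \<open>If \<open>a * c\<close> were positive, it would be at least
      \<open>a * a\<close>, and \<open>n = k - a * c\<close> would be negative because
      \<open>k\<close> is at most \<open>11 / 16\<close> of \<open>a * a\<close>.\<close>
    then have "a * c < 0"
      using eq k_le aa n by auto
    \<comment> \<open>Now \<open>\<bar>a * c\<bar> = n - k\<close> is at most 2, so \<open>a\<close>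
      is a sign, and the bound on \<open>k\<close> then forces \<open>k = 0\<close>.\<close>
    then have "a * a \<le> n - int k"
      using aa eq by auto
    have "a * a < 2 * 2"
      using \<open>a * a \<le> n - int k\<close> n by auto
    then have "\<bar>a\<bar> < 2"
      using abs_square_less_1 power2_less_imp_less[of "\<bar>a\<bar>" 2] by (simp add: power2_eq_square)
    then have a1: "a = 1 \<or> a = -1"
      using a0 by auto
    with k_le have "k = 0"
      by auto
    with a1 eq have "a = 1 \<and> c = - n \<or> a = -1 \<and> c = n"
      by auto
    moreover have "herm x y = 0"
      using k \<open>k = 0\<close> by simp
    ultimately show ?thesis
      using that[OF xM(1) y(1) xM(2) y(2)] a c by auto
  qed
qed

section \<open>Transitivity on vectors of norm 1\<close>

lemma omega_plus_cnj: "omega + cnj omega = 1"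
  by (simp add: cnj_omega)

lemma herm_commuteD: "herm x y = a \<Longrightarrow> herm y x = cnj a"
  by (metis herm_commute)

text \<open>A hyperbolic pair \<open>e\<close>, \<open>f\<close> orthogonal to \<open>v\<close>
  makes \<open>e\<close>, \<open>v\<close>, \<open>f\<close> the columns of an isometry. Each
  reduced Gram matrix yields such a pair because \<open>omega\<close> has trace 1 and so does the
  work of one half.\<close>

lemma norm_1_orbit:
  assumes v: "v \<in> integral_vecs" "herm v v = 1"
  obtains B where "B \<in> integral_UJ" "B *v vector [0, 1, 0] = v"
proof -
  obtain x y where xy: "x \<in> integral_vecs" "y \<in> integral_vecs" "herm x v = 0" "herm y v = 0"
    and cases: "herm x x = 0 \<and> (cmod (herm x y))\<^sup>2 = 1 \<or>
      herm x y = 0 \<and> (herm x x = 1 \<and> herm y y = -1 \<or> herm x x = -1 \<and> herm y y = 1)"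
    using orthogonal_lattice_reduced_basis[of v 1] v by auto
  have "\<exists>e f. e \<in> integral_vecs \<and> f \<in> integral_vecs \<and> herm e v = 0 \<and> herm f v = 0 \<and>
      herm e e = 0 \<and> herm f f = 0 \<and> herm e f = 1"
  proof (cases "herm x x = 0")
    case True
    then have b: "cmod (herm x y) = 1"
      using cases power2_eq_imp_eq[of "cmod (herm x y)" 1] by simp
    \<comment> \<open>The mixed product has modulus 1, so this scaling makes the pairing with
      \<open>x\<close> equal to 1.\<close>
    define f0 where "f0 = herm x y *s y"
    have f0: "f0 \<in> integral_vecs" "herm f0 v = 0"
      unfolding f0_def using xy by (auto simp: herm_linear)
    have "herm x f0 = 1"
      using b complex_norm_square[of "herm x y"] by (simp add: f0_def herm_linear mult.commute)
    note f0 = f0 this herm_commuteD[OF this]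
    obtain m where m: "herm f0 f0 = of_int m"
      using herm_self_int[OF f0(1)] .
    \<comment> \<open>As \<open>x\<close> is isotropic, subtracting \<open>m * omega\<close> times
      \<open>x\<close> changes the norm \<open>m\<close> by \<open>m\<close> times the trace of
      \<open>omega\<close>.\<close>
    define f where "f = f0 - (of_int m * omega) *s x"
    have "herm f f = of_int m - of_int m * (omega + cnj omega)"
      by (simp add: f_def herm_linear f0 True m algebra_simps)
    then have "herm f f = 0"
      unfolding omega_plus_cnj by simp
    moreover have "f \<in> integral_vecs" "herm f v = 0" "herm x f = 1"
      using xy f0 True by (auto simp: f_def herm_linear)
    ultimately show ?thesis
      using xy True by blast
  next
    case False
    \<comment> \<open>In a diagonal lattice of norms 1 and -1, \<open>x + y\<close> is isotropic.
      Its partner has coefficients of equal modulus, hence is isotropic too, and the pairing is the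
      trace of \<open>omega\<close>.\<close>
    have *: ?thesis if "x \<in> integral_vecs" "y \<in> integral_vecs" "herm x v = 0" "herm y v = 0"
      "herm x y = 0" "herm x x = 1" "herm y y = -1" for x y
    proof (intro exI conjI)
      have "herm y x = 0"
        using herm_commuteD[OF that(5)] by simp
      then show "herm (x + y) (x + y) = 0" "herm (x + y) v = 0"
        "herm (cnj omega *s x - omega *s y) v = 0"
        "herm (cnj omega *s x - omega *s y) (cnj omega *s x - omega *s y) = 0"
        "herm (x + y) (cnj omega *s x - omega *s y) = 1"
        using that by (simp_all add: herm_linear omega_plus_cnj)
    qed (use that in auto)
    from False cases have "herm x y = 0"
      "herm x x = 1 \<and> herm y y = -1 \<or> herm x x = -1 \<and> herm y y = 1" by auto
    then show ?thesis
      using *[of x y] *[of y x] xy herm_commuteD[of x y 0] by auto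
  qed
  then obtain e f where ef: "e \<in> integral_vecs" "f \<in> integral_vecs" "herm e v = 0" "herm f v = 0"
    "herm e e = 0" "herm f f = 0" "herm e f = 1"
    by blast
  have "herm v f = 0"
    using herm_commuteD[OF ef(4)] by simp
  then have "cols e v f \<in> UJ"
    using ef v by (intro cols_UJ)
  then have "cols e v f \<in> integral_UJ"
    using ef v by (intro cols_integral_UJ)
  moreover have "cols e v f *v vector [0, 1, 0] = v"
    by (simp add: cols_mult_vec)
  ultimately show ?thesis
    using that by blast
qed

section \<open>Transitivity on primitive vectors of norm 2\<close>

text \<open>In the ring \<open>Zomega / 2\<close>, which is a product of two fields with two elements, every element is
  idempotent.\<close>

lemma Zomega_idempotent_mod_2: "(z * z - z) / 2 \<in> Zomega" if z: "z \<in> Zomega"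
proof -
  obtain m k where eq: "z = of_int m + of_int k * omega"
    using z by (elim ZomegaE)
  have "even (m * m - m)" "even (k * k - k)" by auto
  then obtain s t where st: "m * m - m = 2 * s" "k * k - k = 2 * t"
    by (elim dvdE)
  have "z * z - z = of_int (m * m - m) + of_int (2 * m * k) * omega
      + of_int k * of_int k * (omega * omega) - of_int k * omega"
    unfolding eq by (simp add: algebra_simps)
  also have "\<dots> = of_int (m * m - m) + of_int (2 * m * k + (k * k - k)) * omega - of_int (2 * k * k)"
    unfolding omega_sq by (simp add: algebra_simps)
  also have "\<dots> = 2 * (of_int (s - k * k) + of_int (m * k + t) * omega)"
    unfolding st by (simp add: algebra_simps)
  finally have "(z * z - z) / 2 = of_int (s - k * k) + of_int (m * k + t) * omega"
    by (simp del: of_int_add of_int_diff of_int_mult)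
  then show ?thesis
    using ZomegaI by metis
qed

text \<open>The conjugated Bezout relation and the norm condition show that \<open>p\<close> is a
  multiple of \<open>cnj p\<close> modulo 2. As \<open>cnj p\<close> is idempotent there,
  \<open>p * cnj p\<close> is congruent to \<open>p\<close>, and by conjugation also to
  \<open>cnj p\<close>.\<close>

lemma half_diff_cnj_Zomega:
  assumes Z: "p \<in> Zomega" "q \<in> Zomega" "\<alpha> \<in> Zomega" "\<beta> \<in> Zomega"
    and bezout: "\<alpha> * p + \<beta> * q = 1" and norm: "p * cnj q + cnj p * q = 2"
  shows "(p - cnj p) / 2 \<in> Zomega"
proof -
  define Y where "Y = cnj \<alpha> * p - cnj \<beta> * q"
  have "cnj (\<alpha> * p + \<beta> * q) = 1"
    unfolding bezout by simp
  then have "p = p * (cnj \<alpha> * cnj p + cnj \<beta> * cnj q)"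
    by simp
  also have "\<dots> = cnj p * Y + cnj \<beta> * (p * cnj q + cnj p * q)"
    by (simp add: Y_def algebra_simps)
  finally have p: "p = cnj p * Y + 2 * cnj \<beta>"
    unfolding norm by (simp add: mult.commute)
  have "(p * cnj p - p) / 2 = Y * ((cnj p * cnj p - cnj p) / 2) + cnj \<beta> * (cnj p - 1)"
    by (subst (1 2) p) (simp add: field_simps)
  also have "\<dots> \<in> Zomega"
    unfolding Y_def using Z
    by (intro Zomega_add Zomega_mult Zomega_diff Zomega_cnj Zomega_1 Zomega_idempotent_mod_2)
  finally have 1: "(p * cnj p - p) / 2 \<in> Zomega" .
  have "(p - cnj p) / 2 = cnj ((p * cnj p - p) / 2) - (p * cnj p - p) / 2"
    by (simp add: field_simps)
  then show ?thesis
    using 1 by (metis Zomega_cnj Zomega_diff)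
qed

lemma norm_2_orbit:
  assumes v: "primitive v" "herm v v = 2"
  obtains B where "B \<in> integral_UJ" "B *v vector [1, 0, 1] = v"
proof -
  have vi: "v \<in> integral_vecs"
    using v(1) by (simp add: primitive_def)
  obtain x y where xy: "x \<in> integral_vecs" "y \<in> integral_vecs" "herm x v = 0" "herm y v = 0"
    and cases: "herm x x = 0 \<and> (cmod (herm x y))\<^sup>2 = 2 \<or>
      herm x y = 0 \<and> (herm x x = 1 \<and> herm y y = -2 \<or> herm x x = -1 \<and> herm y y = 2)"
    using orthogonal_lattice_reduced_basis[of v 2] v vi by auto
  have "\<exists>e\<in>integral_vecs. herm e v = 0 \<and> herm e e = 1"
    using cases
  proof (elim disjE conjE)
    assume xx: "herm x x = 0" and b: "(cmod (herm x y))\<^sup>2 = 2"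
    obtain m where m: "herm y y = of_int m"
      using herm_self_int[OF xy(2)] .
    obtain s :: int where s: "herm x y + cnj (herm x y) = of_int s" "s * s = 1"
      using Zomega_cmod_sq_2[OF herm_Zomega[OF xy(1,2)] b] that[of 1] that[of "-1"] by auto
    \<comment> \<open>The coefficient is chosen so that the norm becomes
      \<open>m + (1 - m) * (s * s)\<close>, which is 1 because \<open>s\<close> is a sign.\<close>
    define e where "e = y + of_int ((1 - m) * s) *s x"
    have "herm e e = of_int m + of_int ((1 - m) * s) * (herm x y + herm y x)"
      by (simp add: e_def herm_linear m xx algebra_simps)
    also have "\<dots> = of_int (m + (1 - m) * (s * s))"
      using s(1) herm_commute[of y x] by (simp add: algebra_simps)
    finally have "herm e e = 1"
      by (simp add: s(2))
    moreover have "e \<in> integral_vecs" "herm e v = 0"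
      using xy by (auto simp: e_def herm_linear simp del: of_int_mult)
    ultimately show ?thesis by blast
  next
    assume "herm x y = 0" "herm x x = -1" "herm y y = 2"
    then have "herm (x + y) (x + y) = 1" "herm (x + y) v = 0" "x + y \<in> integral_vecs"
      using xy herm_commuteD[of x y 0] by (auto simp: herm_linear)
    then show ?thesis by blast
  qed (use xy in blast)
  then obtain e where e: "e \<in> integral_vecs" "herm e v = 0" "herm e e = 1"
    by blast
  obtain B where B: "B \<in> integral_UJ" "B *v vector [0, 1, 0] = e"
    using norm_1_orbit[OF e(1,3)] .
  note UJ = integral_UJ_imp_UJ[OF B(1)]
  \<comment> \<open>The preimage of \<open>v\<close> under \<open>B\<close> is orthogonal to the
    preimage \<open>(0,1,0)\<close> of \<open>e\<close>, so its middle entry vanishes.\<close>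
  define w where "w = adj B *v v"
  have Bw: "B *v w = v"
    by (simp add: w_def UJ_adj_mult_vec[OF UJ])
  have wi: "w \<in> integral_vecs"
    unfolding w_def by (intro integral_UJ_mult_vec integral_UJ_adj B vi)
  have "herm w (vector [0, 1, 0]) = herm v e"
    by (simp add: w_def herm_adj B)
  then have "w $ 2 = 0"
    using herm_commuteD[OF e(2)] by (simp add: herm_expand)
  define p q where "p = w $ 1" and "q = w $ 3"
  have w: "w = vector [p, 0, q]"
    using \<open>w $ 2 = 0\<close> by (simp add: p_def q_def vec_eq_iff forall_3)
  have pq: "p \<in> Zomega" "q \<in> Zomega"
    using wi by (auto simp: p_def q_def)
  have "herm w w = 2"
    using UJ_herm[OF UJ, of w w] v by (simp add: Bw)
  then have norm: "p * cnj q + cnj p * q = 2"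
    by (simp add: w herm_expand algebra_simps)
  \<comment> \<open>Primitivity of \<open>v\<close>, carried back by \<open>adj B\<close>, becomes a
    Bezout relation between \<open>p\<close> and \<open>q\<close>.\<close>
  obtain r where r: "r \<in> integral_vecs" "herm v r = 1"
    using v(1) by (auto simp: primitive_def)
  define r' where "r' = adj B *v r"
  have r': "r' \<in> integral_vecs"
    unfolding r'_def by (intro integral_UJ_mult_vec integral_UJ_adj B r)
  have "herm w r' = 1"
    using UJ_herm[OF UJ, of w r'] r(2) by (simp add: Bw r'_def UJ_adj_mult_vec[OF UJ])
  then have bezout: "cnj (r' $ 3) * p + cnj (r' $ 1) * q = 1"
    by (simp add: w herm_expand algebra_simps)
  have "(p - cnj p) / 2 \<in> Zomega"
    by (rule half_diff_cnj_Zomega[OF pq _ _ bezout norm]) (use r' in auto)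
  then have "(p - cnj p) / 2 + cnj p \<in> Zomega"
    using pq by auto
  moreover have "(p - cnj p) / 2 + cnj p = (p + cnj p) / 2"
    by (simp add: field_simps)
  ultimately have p2: "(p + cnj p) / 2 \<in> Zomega"
    by simp
  have q2: "(q - cnj q) / 2 \<in> Zomega"
    by (rule half_diff_cnj_Zomega[OF pq(2,1), of "cnj (r' $ 1)" "cnj (r' $ 3)"])
       (use r' bezout norm in \<open>auto simp: algebra_simps\<close>)
  \<comment> \<open>A real first and an imaginary third entry make \<open>f\<close> isotropic. Its
    pairing with \<open>w\<close> is half the norm of \<open>w\<close>, that is 1, so
    \<open>w - f\<close> is isotropic as well and pairs to 1 with \<open>f\<close>.\<close>
  define f :: "complex^3" where "f = vector [(p + cnj p) / 2, 0, (q - cnj q) / 2]"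
  have f: "f \<in> integral_vecs"
    unfolding f_def by (intro integral_vecs_vector p2 q2 Zomega_0)
  have ff: "herm f f = 0"
    by (simp add: f_def herm_expand field_simps)
  have "herm f w = (p * cnj q + cnj p * q) / 2"
    by (simp add: f_def w herm_expand field_simps)
  then have fw: "herm f w = 1"
    unfolding norm by simp
  define C where "C = cols f (vector [0, 1, 0]) (w - f)"
  have "C \<in> UJ"
    unfolding C_def
    using ff fw herm_commuteD[OF fw] \<open>herm w w = 2\<close>
    by (intro cols_UJ) (simp_all add: herm_linear, simp_all add: f_def w herm_expand)
  then have "C \<in> integral_UJ"
    unfolding C_def using f wi by (intro cols_integral_UJ) auto
  then have "B ** C \<in> integral_UJ"
    using B integral_UJ_mult by blast
  moreover have "C *v vector [1, 0, 1] = w"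
    by (simp add: C_def cols_mult_vec)
  then have "(B ** C) *v vector [1, 0, 1] = v"
    by (simp add: Bw flip: matrix_vector_mul_assoc)
  ultimately show ?thesis
    using that by blast
qed

section \<open>Reflections\<close>

text \<open>For \<open>herm v v\<close> nonzero this is the involution that negates \<open>v\<close>
  and fixes its orthogonal complement.\<close>

definition hrefl :: "complex^3 \<Rightarrow> complex^3^3" where
  "hrefl v = matrix (\<lambda>x. x - (2 * herm x v / herm v v) *s v)"

lemma hrefl_mult_vec: "hrefl v *v x = x - (2 * herm x v / herm v v) *s v"
  unfolding hrefl_def
proof (rule matrix_works)
  show "Vector_Spaces.linear (*s) (*s) (\<lambda>x. x - (2 * herm x v / herm v v) *s v)"
    by unfold_locales
      (simp_all add: herm_linear vec_eq_iff add_divide_distrib algebra_simps)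
qed

lemma hrefl_UJ:
  assumes "herm v v \<noteq> 0"
  shows "hrefl v \<in> UJ"
proof -
  have "herm (hrefl v *v x) (hrefl v *v y) = herm x y" for x y
    using assms herm_commute[of v y] by (simp add: hrefl_mult_vec herm_linear field_simps)
  then show ?thesis
    by (simp add: UJ_def)
qed

lemma hrefl_scale:
  assumes "c \<noteq> 0"
  shows "hrefl (c *s v) = hrefl v"
proof -
  have "hrefl (c *s v) *v x = hrefl v *v x" for x
    using assms by (simp add: hrefl_mult_vec herm_linear)
  then show ?thesis
    by (simp add: matrix_eq)
qed

lemma hrefl_conjugate:
  assumes "B \<in> UJ"
  shows "B ** hrefl v ** adj B = hrefl (B *v v)"
proof -
  have "(B ** hrefl v ** adj B) *v x = hrefl (B *v v) *v x" for x
  proof -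
    have "herm (adj B *v x) v = herm x (B *v v)"
      by (rule herm_adj)
    then show ?thesis
      by (simp add: hrefl_mult_vec UJ_herm[OF assms] UJ_adj_mult_vec[OF assms]
          matrix_vector_mult_diff_distrib vector_scalar_commute flip: matrix_vector_mul_assoc)
  qed
  then show ?thesis
    by (simp add: matrix_eq)
qed

lemma matrix_entry: "A $ i $ j = (A *v axis j 1) $ i" for A :: "'a::semiring_1^'n^'m"
  by (simp add: matrix_vector_mult_def axis_def if_distrib cong: if_cong)

lemma R_mat_eq: "R_mat = hrefl (vector [0, 1, 0])"
proof -
  have "R_mat *v x = hrefl (vector [0, 1, 0]) *v x" for x
    unfolding hrefl_mult_vec
    by (simp add: R_mat_def herm_expand matrix_vector_mult_def sum_3 vec_eq_iff forall_3)
  then show ?thesis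
    by (simp add: matrix_eq)
qed

text \<open>\<open>I_mat\<close> fixes \<open>(1,0,1)\<close> and negates its orthogonal complement,
  so it agrees with the reflection only up to sign.\<close>

lemma I_mat_eq: "I_mat = - hrefl (vector [1, 0, 1])"
proof -
  have "I_mat *v x = (- hrefl (vector [1, 0, 1])) *v x" for x
    unfolding minus_mult_vec hrefl_mult_vec
    by (simp add: I_mat_def herm_expand matrix_vector_mult_def sum_3 vec_eq_iff forall_3 field_simps)
  then show ?thesis
    by (simp add: matrix_eq)
qed

lemma pclass_I_mat: "pclass I_mat = pclass (hrefl (vector [1, 0, 1]))"
  by (simp add: pclass_eq_iff I_mat_eq)

lemma span_singleton: "vec.span {w :: complex^3} = range (\<lambda>k. k *s w)"
  by (rule vec.span_singleton)

lemma span_eqD: "vec.span {x :: complex^3} = vec.span {y} \<Longrightarrow> \<exists>c. x = c *s y"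
  using vec.span_base[of x "{x}"] by (auto simp: span_singleton)

lemma act_span: "act (pclass A) (vec.span {w}) = vec.span {A *v w}"
proof -
  have "act (pclass A) (vec.span {w}) = (*v) A ` vec.span {w}"
    by (rule act_pclass) (rule vec.subspace_span)
  also have "\<dots> = vec.span {A *v w}"
    by (simp add: span_singleton image_image vector_scalar_commute)
  finally show ?thesis .
qed

text \<open>If the line of a negative \<open>w\<close> is fixed, a multiple of \<open>v\<close> with
  factor proportional to \<open>herm w v\<close> is a multiple of \<open>w\<close>. The norms of
  \<open>v\<close> and \<open>w\<close> have opposite signs, so that factor is 0.\<close>

lemma fixed_points_refl:
  assumes v: "Re (herm v v) > 0"
  shows "fixed_points (pclass (hrefl v)) = polar v"
proof (intro equalityI subsetI)
  fix L assume "L \<in> fixed_points (pclass (hrefl v))"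
  then have L: "L \<in> H2C" "act (pclass (hrefl v)) L = L"
    by (auto simp: fixed_points_def)
  then obtain w where w: "L = vec.span {w}" "Re (herm w w) < 0"
    unfolding H2C_def by blast
  obtain c where "hrefl v *v w = c *s w"
    using L(2) span_eqD unfolding w(1) act_span by blast
  then have eq: "(2 * herm w v / herm v v) *s v = (1 - c) *s w"
    by (simp add: hrefl_mult_vec vec_eq_iff algebra_simps)
  have "herm w v = 0"
  proof (rule ccontr)
    assume "herm w v \<noteq> 0"
    define k where "k = 2 * herm w v / herm v v"
    have k: "k \<noteq> 0"
      using \<open>herm w v \<noteq> 0\<close> v by (auto simp: k_def)
    have "Re (herm (k *s v) (k *s v)) = Re (herm ((1 - c) *s w) ((1 - c) *s w))"
      using eq by (simp add: k_def)
    then have "(cmod k)\<^sup>2 * Re (herm v v) = (cmod (1 - c))\<^sup>2 * Re (herm w w)"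
      unfolding herm_scale_self .
    moreover have "(cmod k)\<^sup>2 * Re (herm v v) > 0"
      using k v by simp
    moreover have "(cmod (1 - c))\<^sup>2 * Re (herm w w) \<le> 0"
      using w(2) by (simp add: mult_nonneg_nonpos)
    ultimately show False by simp
  qed
  then show "L \<in> polar v"
    using L(1) w(1) unfolding polar_def by blast
next
  fix L assume "L \<in> polar v"
  then obtain w where w: "L \<in> H2C" "herm w v = 0" "L = vec.span {w}"
    unfolding polar_def by blast
  then show "L \<in> fixed_points (pclass (hrefl v))"
    by (simp add: fixed_points_def act_span hrefl_mult_vec)
qed

lemma hrefl_squared: "hrefl v ** hrefl v = mat 1" if "herm v v \<noteq> 0"
proof -
  have "(hrefl v ** hrefl v) *v x = mat 1 *v x" for x
    using that by (simp add: hrefl_mult_vec herm_linear vec_eq_iff flip: matrix_vector_mul_assoc)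
  then show ?thesis
    by (simp add: matrix_eq)
qed

section \<open>Eigenvalues of isometries that fix a complex line\<close>

lemma orthogonal_decomposition:
  assumes "herm v v \<noteq> 0"
  obtains x' where "x = (herm x v / herm v v) *s v + x'" "herm x' v = 0"
  by (rule that[of "x - (herm x v / herm v v) *s v"]) (use assms in \<open>simp_all add: herm_linear\<close>)

lemma two_eigenvalues_mult_vec:
  assumes v: "herm v v \<noteq> 0" "A *v v = \<mu> *s v" and perp: "\<And>x. herm x v = 0 \<Longrightarrow> A *v x = \<kappa> *s x"
  shows "A *v x = \<kappa> *s x + ((\<mu> - \<kappa>) * herm x v / herm v v) *s v"
proof -
  obtain x' where x: "x = (herm x v / herm v v) *s v + x'" "herm x' v = 0"
    using orthogonal_decomposition[OF v(1)] .
  have "A *v x = (herm x v / herm v v) *s (\<mu> *s v) + \<kappa> *s x'"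
    by (subst x(1)) (simp add: matrix_vector_right_distrib vector_scalar_commute v(2) perp[OF x(2)])
  also have "x' = x - (herm x v / herm v v) *s v"
    using x(1) by (metis add_diff_cancel_left')
  finally show ?thesis
    by (simp add: vec_eq_iff algebra_simps diff_divide_distrib)
qed

text \<open>By \<open>two_eigenvalues_mult_vec\<close> the matrix is a scalar plus a multiple of the
  rank one map that sends \<open>x\<close> to \<open>herm x v *s v\<close>, and the trace of that
  map is \<open>herm v v\<close>.\<close>

lemma trace_two_eigenvalues:
  assumes v: "herm v v \<noteq> 0" "A *v v = \<mu> *s v" and perp: "\<And>x. herm x v = 0 \<Longrightarrow> A *v x = \<kappa> *s x"
  shows "trace A = 2 * \<kappa> + \<mu>"
proof -
  have "A $ i $ i = \<kappa> + (\<mu> - \<kappa>) / herm v v * (herm (axis i 1) v * v $ i)" for i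
  proof -
    have "A $ i $ i = (A *v axis i 1) $ i"
      by (rule matrix_entry)
    also have "A *v axis i 1 = \<kappa> *s axis i 1 + ((\<mu> - \<kappa>) * herm (axis i 1) v / herm v v) *s v"
      by (rule two_eigenvalues_mult_vec[OF v perp])
    finally show ?thesis
      by (simp add: axis_def)
  qed
  then have "trace A = 3 * \<kappa> + (\<mu> - \<kappa>) / herm v v * (\<Sum>i\<in>UNIV. herm (axis i 1) v * v $ i)"
    unfolding trace_def by (simp add: sum.distrib sum_distrib_left)
  also have "(\<Sum>i\<in>UNIV. herm (axis i 1) v * v $ i) = herm v v"
    by (simp add: sum_3 herm_expand axis_def)
  finally show ?thesis
    using v(1) by simp
qed

lemma trace_refl: "trace (hrefl v) = 1" if "herm v v \<noteq> 0"
  using trace_two_eigenvalues[of v "hrefl v" "-1" 1] that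
  by (simp add: hrefl_mult_vec vec_eq_iff)

text \<open>Removing from a vector of norm -2 its component along the positive vector
  \<open>v\<close> can only lower the norm further.\<close>

lemma negative_vector_orthogonal:
  assumes "Re (herm v v) > 0"
  obtains w where "herm w v = 0" "Re (herm w w) < 0"
proof -
  have v0: "herm v v \<noteq> 0"
    using assms by auto
  define m :: "complex^3" where "m = vector [1, 0, -1]"
  obtain w where w: "m = (herm m v / herm v v) *s v + w" "herm w v = 0"
    using orthogonal_decomposition[OF v0] .
  define c where "c = herm m v / herm v v"
  have "herm v w = 0"
    using herm_commuteD[OF w(2)] by simp
  have "herm m m = herm (c *s v + w) (c *s v + w)"
    using w(1) by (simp add: c_def)
  also have "\<dots> = herm (c *s v) (c *s v) + herm w w"
    using w(2) \<open>herm v w = 0\<close> by (simp add: herm_linear)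
  finally have "Re (herm m m) = (cmod c)\<^sup>2 * Re (herm v v) + Re (herm w w)"
    by (simp add: herm_scale_self)
  moreover have "Re (herm m m) = -2"
    by (simp add: m_def herm_expand)
  moreover have "(cmod c)\<^sup>2 * Re (herm v v) \<ge> 0"
    using assms by simp
  ultimately show ?thesis
    using that w(2) by auto
qed

lemma UJ_eigenvalue_cmod:
  assumes "A \<in> UJ" "A *v x = c *s x" "herm x x \<noteq> 0"
  shows "cmod c = 1"
proof -
  have "c * cnj c * herm x x = herm x x"
    using UJ_herm[OF assms(1), of x x] by (simp add: assms(2) herm_linear mult_ac)
  then have "c * cnj c = 1"
    using assms(3) by simp
  then have "of_real ((cmod c)\<^sup>2) = (1 :: complex)"
    by (simp only: complex_norm_square)
  then have "(cmod c)\<^sup>2 = 1"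
    by (simp only: of_real_eq_1_iff)
  then show ?thesis
    using power2_eq_imp_eq[of "cmod c" 1] by simp
qed

text \<open>Every negative vector orthogonal to \<open>v\<close> is an eigenvector. Perturbing one
  such \<open>w\<close> shows that all of the orthogonal complement shares its eigenvalue; since
  \<open>A\<close> preserves orthogonality, \<open>v\<close> is then an eigenvector too.\<close>

lemma fixed_polar_eigenvalues:
  assumes A: "A \<in> UJ" and v: "Re (herm v v) > 0" and fp: "polar v \<subseteq> fixed_points (pclass A)"
  obtains \<kappa> \<mu> where "cmod \<kappa> = 1" "cmod \<mu> = 1" "A *v v = \<mu> *s v" "\<And>x. herm x v = 0 \<Longrightarrow> A *v x = \<kappa> *s x"
    "\<exists>x. x \<noteq> 0 \<and> A *v x = \<kappa> *s x"
proof -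
  have neg: "\<exists>c. A *v w = c *s w" if w: "herm w v = 0" "Re (herm w w) < 0" for w
  proof -
    have "vec.span {w} \<in> polar v"
      unfolding polar_def H2C_def using w by blast
    with fp have "act (pclass A) (vec.span {w}) = vec.span {w}"
      by (auto simp: fixed_points_def)
    then show ?thesis
      unfolding act_span by (rule span_eqD)
  qed
  obtain w where w: "herm w v = 0" "Re (herm w w) < 0"
    using negative_vector_orthogonal[OF v] .
  then obtain \<kappa> where \<kappa>: "A *v w = \<kappa> *s w"
    using neg by blast
  have w0: "herm w w \<noteq> 0"
    using w(2) by auto
  have \<kappa>1: "cmod \<kappa> = 1"
    using UJ_eigenvalue_cmod[OF A \<kappa> w0] .
  have orth: "A *v x = \<kappa> *s x" if x: "herm x v = 0" "herm x w = 0" for x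
  proof -
    \<comment> \<open>Large enough that \<open>K\<close> times \<open>w\<close> plus
      \<open>x\<close> is still negative, hence an eigenvector.\<close>
    define K where "K = 1 + \<bar>Re (herm x x)\<bar> / - Re (herm w w)"
    have "\<bar>Re (herm x x)\<bar> / - Re (herm w w) \<ge> 0"
      using w(2) by (intro divide_nonneg_pos) auto
    then have "K \<ge> 1"
      unfolding K_def by linarith
    have "K * - Re (herm w w) = - Re (herm w w) + \<bar>Re (herm x x)\<bar>"
      using w(2) by (simp add: K_def field_simps)
    moreover have "K * - Re (herm w w) \<le> K * (K * - Re (herm w w))"
      using \<open>K \<ge> 1\<close> w(2) mult_right_mono[of 1 K "K * - Re (herm w w)"] by simp
    moreover have "K * (K * - Re (herm w w)) = - (K * (K * Re (herm w w)))"
      by simp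
    ultimately have K: "K * (K * Re (herm w w)) + Re (herm x x) < 0"
      using w(2) abs_ge_self[of "Re (herm x x)"] by linarith
    have "herm w x = 0"
      using herm_commuteD[OF x(2)] by simp
    then have "Re (herm (of_real K *s w + x) (of_real K *s w + x)) < 0"
      using K x(2) by (simp add: herm_linear)
    moreover have "herm (of_real K *s w + x) v = 0"
      using w x by (simp add: herm_linear)
    ultimately obtain c where "A *v (of_real K *s w + x) = c *s (of_real K *s w + x)"
      using neg by blast
    then have Ax: "A *v x = (of_real K * (c - \<kappa>)) *s w + c *s x"
      by (simp add: matrix_vector_right_distrib vector_scalar_commute \<kappa> vec_eq_iff algebra_simps)
    \<comment> \<open>\<open>A\<close> keeps \<open>x\<close> orthogonal to \<open>w\<close>, so the
      component of \<open>A *v x\<close> along \<open>w\<close> vanishes, which identifies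
      \<open>c\<close> with \<open>\<kappa>\<close>.\<close>
    have "herm (A *v x) (A *v w) = 0"
      using UJ_herm[OF A] x(2) by simp
    then have "cnj \<kappa> * (of_real K * (c - \<kappa>) * herm w w) = 0"
      by (simp add: Ax \<kappa> herm_linear x(2))
    then have "c = \<kappa>"
      using \<kappa>1 w0 \<open>K \<ge> 1\<close> by auto
    then show ?thesis
      using Ax by simp
  qed
  have perp: "A *v x = \<kappa> *s x" if x: "herm x v = 0" for x
  proof -
    obtain x' where x': "x = (herm x w / herm w w) *s w + x'" "herm x' w = 0"
      using orthogonal_decomposition[OF w0] .
    have "herm x' v = herm (x - (herm x w / herm w w) *s w) v"
      using x'(1) by (metis add_diff_cancel_left')
    also have "\<dots> = 0"
      using x w by (simp add: herm_linear)
    finally have "A *v x' = \<kappa> *s x'"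
      using orth x'(2) by blast
    then show ?thesis
      by (subst (1 2) x'(1))
        (simp add: matrix_vector_right_distrib vector_scalar_commute \<kappa> vec_eq_iff algebra_simps)
  qed
  have v0: "herm v v \<noteq> 0"
    using v by auto
  obtain z where z: "A *v v = (herm (A *v v) v / herm v v) *s v + z" "herm z v = 0"
    using orthogonal_decomposition[OF v0] .
  \<comment> \<open>\<open>A\<close> acts on the complement of \<open>v\<close> by a nonzero scalar,
    so \<open>A *v v\<close> is orthogonal to that complement; \<open>z\<close> is then orthogonal
    to it and to \<open>v\<close>.\<close>
  have "z = 0"
  proof (rule herm_nondegenerate)
    fix y
    obtain y' where y: "y = (herm y v / herm v v) *s v + y'" "herm y' v = 0"
      using orthogonal_decomposition[OF v0] .
    have "herm v y' = 0"
      using herm_commuteD[OF y(2)] by simp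
    then have "herm (A *v v) (A *v y') = 0"
      by (simp add: UJ_herm[OF A])
    then have "herm (A *v v) y' = 0"
      unfolding perp[OF y(2)] using \<kappa>1 by (auto simp: herm_linear)
    then have "herm z y' = 0"
      using z(1) \<open>herm v y' = 0\<close> by (metis add_0 herm_add_left herm_scale_left mult_zero_right)
    then show "herm z y = herm 0 y"
      by (subst y(1)) (simp add: herm_linear z(2))
  qed
  then obtain \<mu> where \<mu>: "A *v v = \<mu> *s v"
    using z(1) by auto
  show ?thesis
  proof (rule that)
    show "cmod \<kappa> = 1" "A *v v = \<mu> *s v" "\<And>x. herm x v = 0 \<Longrightarrow> A *v x = \<kappa> *s x"
      by (fact \<kappa>1 \<mu> perp)+
    show "cmod \<mu> = 1"
      by (rule UJ_eigenvalue_cmod[OF A \<mu> v0])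
    show "\<exists>x. x \<noteq> 0 \<and> A *v x = \<kappa> *s x"
      using \<kappa> w0 by (intro exI[of _ w]) auto
  qed
qed

section \<open>Finite order and integrality of eigenvalues\<close>

lemma UJ_O7_pow_eigenvector:
  assumes "A *v x = c *s x"
  shows "(A [^]\<^bsub>UJ_O7\<^esub> (n::nat)) *v x = c ^ n *s x"
  by (induction n) (simp_all add: assms vector_scalar_commute flip: matrix_vector_mul_assoc)

lemma PU_pow: "A \<in> integral_UJ \<Longrightarrow> pclass A [^]\<^bsub>PU_J_O7\<^esub> (n::nat) = pclass (A [^]\<^bsub>UJ_O7\<^esub> n)"
  unfolding PU_J_O7_def pclass_def by (rule sign.FactGroup_pow) (simp add: carrier_UJ_O7)

lemma algebraic_int_root_of_unity:
  assumes "z ^ n = 1" "n > 0"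
  shows "algebraic_int (z :: complex)"
  by (rule algebraic_int_root[of 1 "Polynomial.monom 1 n"])
     (use assms in \<open>auto simp: poly_monom degree_monom_eq\<close>)

text \<open>Torsion in the quotient only makes a power of the matrix plus or minus the identity;
  doubling the exponent turns \<open>c\<close> into a root of unity.\<close>

lemma torsion_eigenvalue_algebraic_int:
  assumes "A \<in> integral_UJ" "pclass A [^]\<^bsub>PU_J_O7\<^esub> n = \<one>\<^bsub>PU_J_O7\<^esub>" "n > (0::nat)"
    and x: "A *v x = c *s x" "x \<noteq> 0"
  shows "algebraic_int c"
proof -
  have "A [^]\<^bsub>UJ_O7\<^esub> n = mat 1 \<or> A [^]\<^bsub>UJ_O7\<^esub> n = - mat 1"
    using assms(1,2) by (simp add: PU_pow one_PU pclass_eq_iff)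
  then have "c ^ n *s x = x \<or> c ^ n *s x = - x"
    using UJ_O7_pow_eigenvector[OF x(1), of n] by (auto simp: minus_mult_vec)
  moreover obtain i where "x $ i \<noteq> 0"
    using x(2) by (auto simp: vec_eq_iff)
  moreover from calculation have "c ^ n * x $ i = x $ i \<or> c ^ n * x $ i = - x $ i"
    by (metis vector_smult_component vector_uminus_component)
  ultimately have "c ^ n = 1 \<or> c ^ n = -1"
    using mult_right_cancel[of "x $ i" "c ^ n" 1] mult_right_cancel[of "x $ i" "c ^ n" "-1"] by auto
  then have "c ^ (2 * n) = 1"
    by (auto simp: power_mult power2_eq_square mult.commute[of 2])
  then show ?thesis
    by (rule algebraic_int_root_of_unity) (use assms in simp)
qed

lemma trace_Zomega: "A \<in> integral_UJ \<Longrightarrow> trace A \<in> Zomega"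
  by (auto simp: trace_def integral_UJ_def)

text \<open>The double eigenvalue lies in the field generated by the traces of \<open>A\<close>, \<open>A\<^sup>2\<close> and \<open>A\<^sup>3\<close>.\<close>

lemma double_root_power_sums:
  fixes \<kappa> \<mu> :: complex
  assumes "\<kappa> \<noteq> \<mu>" and p: "p1 = 2 * \<kappa> + \<mu>" "p2 = 2 * \<kappa>\<^sup>2 + \<mu>\<^sup>2" "p3 = 2 * \<kappa> ^ 3 + \<mu> ^ 3"
  shows "\<kappa> = (4 * p1 * p2 - 3 * p3 - p1 ^ 3) / (3 * p2 - p1\<^sup>2)" "3 * p2 - p1\<^sup>2 \<noteq> 0"
proof -
  have *: "3 * p2 - p1\<^sup>2 = 2 * (\<kappa> - \<mu>)\<^sup>2"
    unfolding p by (simp add: algebra_simps power2_eq_square)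
  then show "3 * p2 - p1\<^sup>2 \<noteq> 0"
    using assms(1) by simp
  have "4 * p1 * p2 - 3 * p3 - p1 ^ 3 = \<kappa> * (2 * (\<kappa> - \<mu>)\<^sup>2)"
    unfolding p by (simp add: algebra_simps power2_eq_square power3_eq_cube)
  then show "\<kappa> = (4 * p1 * p2 - 3 * p3 - p1 ^ 3) / (3 * p2 - p1\<^sup>2)"
    unfolding * using assms(1) by simp
qed

lemma complex_reflection_refl:
  assumes "is_complex_reflection g"
  obtains v where "Re (herm v v) > 0" "hrefl v \<in> integral_UJ" "g = pclass (hrefl v)"
proof -
  obtain A where A: "A \<in> integral_UJ" "g = pclass A"
    using assms unfolding is_complex_reflection_def carrier_PU by blast
  obtain n :: nat where n: "n > 0" "g [^]\<^bsub>PU_J_O7\<^esub> n = \<one>\<^bsub>PU_J_O7\<^esub>"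
    using assms unfolding is_complex_reflection_def by blast
  obtain v where v: "Re (herm v v) > 0" "fixed_points g = polar v"
    using assms unfolding is_complex_reflection_def is_complex_line_def by blast
  have v0: "herm v v \<noteq> 0" "v \<noteq> 0"
    using v by auto
  have "polar v \<subseteq> fixed_points (pclass A)"
    using v(2) A(2) by simp
  then obtain \<kappa> \<mu> where cm: "cmod \<kappa> = 1" "cmod \<mu> = 1" and \<mu>: "A *v v = \<mu> *s v"
    and \<kappa>: "\<And>x. herm x v = 0 \<Longrightarrow> A *v x = \<kappa> *s x" and ex: "\<exists>x. x \<noteq> 0 \<and> A *v x = \<kappa> *s x"
    using fixed_polar_eigenvalues[OF integral_UJ_imp_UJ[OF A(1)] v(1)] by blast
  have A_eq: "A *v x = \<kappa> *s x + ((\<mu> - \<kappa>) * herm x v / herm v v) *s v" for x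
    by (rule two_eigenvalues_mult_vec[OF v0(1) \<mu> \<kappa>])
  have ne: "\<kappa> \<noteq> \<mu>"
  proof
    assume "\<kappa> = \<mu>"
    \<comment> \<open>A scalar \<open>\<kappa>\<close> would be a matrix entry, hence integral of
      modulus 1, hence a sign, and \<open>g\<close> would be trivial.\<close>
    then have scalar: "A *v x = \<kappa> *s x" for x
      unfolding A_eq by simp
    have "A $ 1 $ 1 = (A *v axis 1 1) $ 1"
      by (rule matrix_entry)
    then have "\<kappa> = A $ 1 $ 1"
      unfolding scalar by (simp add: axis_def)
    then have "\<kappa> \<in> Zomega"
      using A(1) by (simp add: integral_UJ_def)
    then have "\<kappa> = 1 \<or> \<kappa> = -1"
      using Zomega_cmod_1 cm by blast
    then have "A = mat 1 \<or> A = - mat 1"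
      using scalar by (auto simp: matrix_eq minus_mult_vec)
    then have "g = \<one>\<^bsub>PU_J_O7\<^esub>"
      by (simp add: A(2) one_PU pclass_eq_iff)
    then show False
      using assms by (simp add: is_complex_reflection_def)
  qed
  have p1: "trace A = 2 * \<kappa> + \<mu>"
    by (rule trace_two_eigenvalues[OF v0(1) \<mu> \<kappa>])
  have p2: "trace (A ** A) = 2 * \<kappa>\<^sup>2 + \<mu>\<^sup>2"
    by (rule trace_two_eigenvalues[OF v0(1)])
      (simp_all add: \<mu> \<kappa> vector_scalar_commute power2_eq_square flip: matrix_vector_mul_assoc)
  have p3: "trace (A ** (A ** A)) = 2 * \<kappa> ^ 3 + \<mu> ^ 3"
    by (rule trace_two_eigenvalues[OF v0(1)])
      (simp_all add: \<mu> \<kappa> vector_scalar_commute power3_eq_cube flip: matrix_vector_mul_assoc)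
  note roots = double_root_power_sums[OF ne p1 p2 p3]
  have tr: "trace A \<in> Zomega" "trace (A ** A) \<in> Zomega" "trace (A ** (A ** A)) \<in> Zomega"
    by (intro trace_Zomega integral_UJ_mult A(1))+
  have "\<kappa> \<in> Q_sqrt_minus7"
    by (subst roots(1)) (intro fraction_Q_sqrt_minus7 Zomega_diff Zomega_mult Zomega_power Zomega_numeral tr)
  moreover have "algebraic_int \<kappa>"
    using ex torsion_eigenvalue_algebraic_int[OF A(1)] n A(2) by blast
  ultimately have "\<kappa> \<in> Zomega"
    by (rule Q_sqrt_minus7_algebraic_int)
  have "\<mu> = trace A - 2 * \<kappa>"
    by (simp add: p1)
  then have "\<mu> \<in> Zomega"
    using tr(1) \<open>\<kappa> \<in> Zomega\<close> by (metis Zomega_diff Zomega_mult Zomega_numeral)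
  \<comment> \<open>Two distinct signs leave two cases, which replacing \<open>A\<close> by
    \<open>- A\<close> exchanges.\<close>
  then have *: "\<kappa> = 1 \<and> \<mu> = -1 \<or> \<kappa> = -1 \<and> \<mu> = 1"
    using Zomega_cmod_1 \<open>\<kappa> \<in> Zomega\<close> cm ne by blast
  then have A_refl: "hrefl v = A \<or> hrefl v = - A"
  proof (elim disjE conjE)
    assume "\<kappa> = 1" "\<mu> = -1"
    then have "hrefl v *v x = A *v x" for x
      unfolding hrefl_mult_vec A_eq by (simp add: vec_eq_iff)
    then show ?thesis
      by (simp add: matrix_eq)
  next
    assume "\<kappa> = -1" "\<mu> = 1"
    then have "hrefl v *v x = (- A) *v x" for x
      unfolding hrefl_mult_vec minus_mult_vec A_eq by (simp add: vec_eq_iff)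
    then show ?thesis
      by (simp add: matrix_eq)
  qed
  then have "hrefl v \<in> integral_UJ"
    using A(1) minus_integral_UJ by auto
  moreover have "g = pclass (hrefl v)"
    using A_refl A(2) by (auto simp: pclass_eq_iff)
  ultimately show ?thesis
    using that v(1) by blast
qed

section \<open>Integral roots and conjugacy of reflections\<close>

text \<open>The difference of an integral \<open>x\<close> and its reflection is an integral
  multiple of the root, so the root can be rescaled to a primitive vector. Testing integrality on a
  \<open>q\<close> with \<open>herm v q = 1\<close> shows that \<open>2 / herm v v\<close> lies in
  the ring.\<close>

lemma integral_reflection_root:
  assumes v0: "Re (herm v0 v0) > 0" and S: "hrefl v0 \<in> integral_UJ"
  obtains v where "primitive v" "herm v v \<in> {1, 2}" "hrefl v = hrefl v0"
proof -
  have ne: "herm v0 v0 \<noteq> 0"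
    using v0 by auto
  have "\<exists>x\<in>integral_vecs. herm x v0 \<noteq> 0"
  proof (rule ccontr)
    assume "\<not> ?thesis"
    then have "\<And>a b c. a \<in> Zomega \<Longrightarrow> b \<in> Zomega \<Longrightarrow> c \<in> Zomega \<Longrightarrow> herm (vector [a, b, c]) v0 = 0"
      using integral_vecs_vector by blast
    from this[of 1 0 0] this[of 0 1 0] this[of 0 0 1] have "v0 = 0"
      by (simp add: herm_expand vec_eq_iff forall_3)
    with ne show False by simp
  qed
  then obtain x where x: "x \<in> integral_vecs" "herm x v0 \<noteq> 0" by blast
  define k where "k = 2 * herm x v0 / herm v0 v0"
  have k: "k \<noteq> 0"
    using x ne by (simp add: k_def)
  have "k *s v0 = x - hrefl v0 *v x"
    by (simp add: hrefl_mult_vec k_def)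
  then have "k *s v0 \<in> integral_vecs"
    using integral_UJ_mult_vec[OF S x(1)] x(1) by (metis integral_vecs_diff)
  moreover have "k *s v0 \<noteq> 0"
    using k ne by (auto simp: vector_mul_eq_0)
  ultimately obtain d v where d: "d \<noteq> 0" "primitive v" "k *s v0 = d *s v"
    using primitive_part[of "k *s v0"] by blast
  define c where "c = k / d"
  have c: "c \<noteq> 0"
    using k d(1) by (simp add: c_def)
  have "v = (1 / d) *s (d *s v)"
    using d(1) by (simp add: vec_eq_iff)
  then have v: "v = c *s v0"
    unfolding d(3) [symmetric] by (simp add: c_def vec_eq_iff)
  have S': "hrefl v = hrefl v0"
    unfolding v by (rule hrefl_scale[OF c])
  obtain q where q: "q \<in> integral_vecs" "herm v q = 1"
    using d(2) by (auto simp: primitive_def)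
  have qv: "herm q v = 1"
    using herm_commuteD[OF q(2)] by simp
  have "herm (q - hrefl v *v q) q = 2 / herm v v"
    by (simp add: hrefl_mult_vec herm_linear q(2) qv)
  moreover have "q - hrefl v *v q \<in> integral_vecs"
    using integral_UJ_mult_vec[OF S q(1)] q(1) unfolding S' by blast
  ultimately have Z: "2 / herm v v \<in> Zomega"
    using herm_Zomega[OF _ q(1)] by metis
  obtain m where m: "herm v v = of_int m"
    using herm_self_int d(2) unfolding primitive_def by blast
  have "real_of_int m = Re (herm v v)"
    by (simp add: m)
  also have "\<dots> = (cmod c)\<^sup>2 * Re (herm v0 v0)"
    unfolding v by (rule herm_scale_self)
  finally have "real_of_int m = (cmod c)\<^sup>2 * Re (herm v0 v0)" .
  then have "real_of_int m > 0"
    using c v0 by simp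
  then have m0: "m > 0" by simp
  have "2 / herm v v \<in> \<real>"
    unfolding m by simp
  then obtain j where j: "2 / herm v v = of_int j"
    using Zomega_real[OF Z] by blast
  then have "of_int (m * j) = (of_int 2 :: complex)"
    using m m0 by (simp add: field_simps)
  then have "m * j = 2"
    by (simp only: of_int_eq_iff)
  then have "m dvd 2"
    by (metis dvd_triv_left)
  then have "m \<le> 2"
    using zdvd_imp_le by simp
  with m0 have "m = 1 \<or> m = 2" by auto
  then show ?thesis
    using that[OF d(2) _ S'] m by auto
qed

lemma conj_class_refl:
  assumes "B \<in> integral_UJ" "hrefl v \<in> integral_UJ"
  shows "conj_class PU_J_O7 (pclass (hrefl (B *v v))) = conj_class PU_J_O7 (pclass (hrefl v))"
proof -
  have "pclass (hrefl (B *v v)) = pclass B \<otimes>\<^bsub>PU_J_O7\<^esub> pclass (hrefl v) \<otimes>\<^bsub>PU_J_O7\<^esub> inv\<^bsub>PU_J_O7\<^esub> (pclass B)"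
    using assms by (simp add: inv_PU mult_PU integral_UJ_mult integral_UJ_adj
        hrefl_conjugate integral_UJ_imp_UJ)
  then show ?thesis
    using conj_class_conjugate[OF group_PU] assms by (simp add: carrier_PU)
qed

lemma hrefl_integral_UJ:
  assumes "v \<in> integral_vecs" "herm v v \<in> {1, 2}"
  shows "hrefl v \<in> integral_UJ"
proof -
  have "2 / herm v v \<in> Zomega"
    using assms(2) by auto
  have "hrefl v $ i $ j \<in> Zomega" for i j
  proof -
    have ax: "axis j 1 \<in> integral_vecs"
      by (simp add: integral_vecs_def axis_def)
    have "hrefl v $ i $ j = (hrefl v *v axis j 1) $ i"
      by (rule matrix_entry)
    also have "hrefl v *v axis j 1 = axis j 1 - (2 / herm v v * herm (axis j 1) v) *s v"
      by (simp add: hrefl_mult_vec)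
    also have "\<dots> $ i \<in> Zomega"
      using ax \<open>2 / herm v v \<in> Zomega\<close> assms(1) by (intro integral_vecs_nth) blast
    finally show ?thesis .
  qed
  moreover have "hrefl v \<in> UJ"
    by (rule hrefl_UJ) (use assms(2) in auto)
  ultimately show ?thesis
    by (simp add: integral_UJ_def)
qed

lemma hrefl_complex_reflection:
  assumes "v \<in> integral_vecs" "herm v v \<in> {1, 2}"
  shows "is_complex_reflection (pclass (hrefl v))" "group.ord PU_J_O7 (pclass (hrefl v)) = 2"
    "mirror (pclass (hrefl v)) = polar v"
proof -
  have S: "hrefl v \<in> integral_UJ"
    by (rule hrefl_integral_UJ[OF assms])
  have v0: "herm v v \<noteq> 0" and pos: "Re (herm v v) > 0"
    using assms(2) by auto
  show mirror: "mirror (pclass (hrefl v)) = polar v"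
    by (rule fixed_points_refl[OF pos])
  have carr: "pclass (hrefl v) \<in> carrier PU_J_O7"
    using S by (simp add: carrier_PU)
  have sq: "pclass (hrefl v) [^]\<^bsub>PU_J_O7\<^esub> (2::nat) = \<one>\<^bsub>PU_J_O7\<^esub>"
  proof -
    have "pclass (hrefl v) [^]\<^bsub>PU_J_O7\<^esub> (2::nat) = pclass (hrefl v) \<otimes>\<^bsub>PU_J_O7\<^esub> pclass (hrefl v)"
      using carr by (simp add: numeral_2_eq_2)
    also have "\<dots> = \<one>\<^bsub>PU_J_O7\<^esub>"
      by (simp add: mult_PU S hrefl_squared[OF v0] one_PU)
    finally show ?thesis .
  qed
  have nontriv: "pclass (hrefl v) \<noteq> \<one>\<^bsub>PU_J_O7\<^esub>"
  proof
    assume "pclass (hrefl v) = \<one>\<^bsub>PU_J_O7\<^esub>"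
    then have "hrefl v = mat 1 \<or> hrefl v = - mat 1"
      by (simp add: one_PU pclass_eq_iff)
    then have "trace (hrefl v) = 3 \<or> trace (hrefl v) = -3"
      by (auto simp: trace_def mat_def sum_3)
    then show False
      by (simp add: trace_refl[OF v0])
  qed
  show "is_complex_reflection (pclass (hrefl v))"
    unfolding is_complex_reflection_def is_complex_line_def mirror
    using carr nontriv sq pos by (auto intro: exI[of _ "2::nat"])
  have "PU.ord (pclass (hrefl v)) dvd 2"
    using sq PU.pow_eq_id[OF carr] by blast
  then have "PU.ord (pclass (hrefl v)) = 1 \<or> PU.ord (pclass (hrefl v)) = 2"
    using prime_nat_iff two_is_prime_nat by blast
  then show "group.ord PU_J_O7 (pclass (hrefl v)) = 2"
    using PU.ord_eq_1[OF carr] nontriv by blast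
qed

text \<open>Conjugacy would make a norm 1 vector with integral entries a multiple of
  \<open>(1,0,1)\<close>, but the norm of such a multiple is twice the squared modulus of an entry,
  an even integer.\<close>

lemma norm_1_not_conjugate_norm_2:
  assumes "v \<in> integral_vecs" "herm v v = 1"
  shows "conj_class PU_J_O7 (pclass (hrefl v)) \<noteq> conj_class PU_J_O7 (pclass (hrefl (vector [1, 0, 1])))"
proof
  define u :: "complex^3" where "u = vector [1, 0, 1]"
  assume "conj_class PU_J_O7 (pclass (hrefl v)) = conj_class PU_J_O7 (pclass (hrefl (vector [1, 0, 1])))"
  then have eq: "conj_class PU_J_O7 (pclass (hrefl v)) = conj_class PU_J_O7 (pclass (hrefl u))"
    by (simp add: u_def)
  have u: "u \<in> integral_vecs" "herm u u = 2"
    by (auto simp: u_def herm_expand)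
  have S: "hrefl v \<in> integral_UJ" "hrefl u \<in> integral_UJ"
    using hrefl_integral_UJ assms u by simp_all
  then obtain h where h: "h \<in> carrier PU_J_O7"
    "pclass (hrefl u) = h \<otimes>\<^bsub>PU_J_O7\<^esub> pclass (hrefl v) \<otimes>\<^bsub>PU_J_O7\<^esub> inv\<^bsub>PU_J_O7\<^esub> h"
    using conj_class_eqD[OF group_PU _ _ eq] by (auto simp: carrier_PU)
  then obtain B where B: "B \<in> integral_UJ" "h = pclass B"
    by (auto simp: carrier_PU)
  define x where "x = B *v v"
  have x: "x \<in> integral_vecs" "herm x x = 1"
    unfolding x_def using integral_UJ_mult_vec[OF B(1) assms(1)] UJ_herm[OF integral_UJ_imp_UJ[OF B(1)]] assms(2)
    by simp_all
  have "pclass (hrefl u) = pclass (hrefl x)"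
    using h(2) B S by (simp add: inv_PU mult_PU integral_UJ_mult integral_UJ_adj
        hrefl_conjugate integral_UJ_imp_UJ x_def)
  then have "hrefl u = hrefl x \<or> hrefl u = - hrefl x"
    by (simp add: pclass_eq_iff)
  \<comment> \<open>Both traces are 1, which excludes the minus sign left open by the
    quotient.\<close>
  moreover have "trace (hrefl u) = 1" "trace (hrefl x) = 1"
    using u x by (simp_all add: trace_refl)
  moreover have "trace (- hrefl x) = - trace (hrefl x)"
    by (simp add: trace_def sum_negf)
  ultimately have "hrefl u = hrefl x" by auto
  \<comment> \<open>Evaluated at its own root \<open>x\<close>, the second reflection gives
    \<open>- x\<close>, which exhibits \<open>x\<close> as a multiple of \<open>u\<close>.\<close>
  then have "hrefl u *v x = hrefl x *v x" by simp
  then have "2 *s x = herm x u *s u"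
    by (simp add: hrefl_mult_vec x u vec_eq_iff algebra_simps)
  then have "x $ 2 = 0" "x $ 1 = x $ 3"
    by (simp_all add: vec_eq_iff forall_3 u_def) (metis mult_cancel_left zero_neq_numeral)
  then have "x $ 1 * cnj (x $ 1) + x $ 1 * cnj (x $ 1) = 1"
    using x(2) by (simp add: herm_expand algebra_simps)
  then have "of_real (2 * (cmod (x $ 1))\<^sup>2) = (1 :: complex)"
    by (simp flip: complex_norm_square)
  then have "2 * (cmod (x $ 1))\<^sup>2 = 1"
    by (simp only: of_real_eq_1_iff)
  moreover obtain k where "(cmod (x $ 1))\<^sup>2 = real k"
    using Zomega_cmod_sq x(1) by blast
  ultimately have "real (2 * k) = real 1"
    by simp
  then show False
    by (simp only: of_nat_eq_iff) presburger
qed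

theorem mainTheorem1:
  shows "card {conj_class PU_J_O7 g | g. is_complex_reflection g} = 2
    \<and> {conj_class PU_J_O7 g | g. is_complex_reflection g}
        = {conj_class PU_J_O7 (pclass R_mat), conj_class PU_J_O7 (pclass I_mat)}
    \<and> is_complex_reflection (pclass R_mat)
    \<and> is_complex_reflection (pclass I_mat)
    \<and> group.ord PU_J_O7 (pclass R_mat) = 2
    \<and> group.ord PU_J_O7 (pclass I_mat) = 2
    \<and> mirror (pclass R_mat) = polar (vector [0, 1, 0])
    \<and> herm (vector [0, 1, 0]) (vector [0, 1, 0]) = 1
    \<and> mirror (pclass I_mat) = polar (vector [1, 0, 1])
    \<and> herm (vector [1, 0, 1]) (vector [1, 0, 1]) = 2"
proof -
  have r: "vector [0, 1, 0] \<in> integral_vecs" "herm (vector [0, 1, 0]) (vector [0, 1, 0]) = 1"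
    by (auto simp: herm_expand)
  have i: "vector [1, 0, 1] \<in> integral_vecs" "herm (vector [1, 0, 1]) (vector [1, 0, 1]) = 2"
    by (auto simp: herm_expand)
  note R = hrefl_complex_reflection[OF r(1), folded R_mat_eq]
  note I = hrefl_complex_reflection[OF i(1), folded pclass_I_mat]
  have SR: "hrefl (vector [0, 1, 0]) \<in> integral_UJ" and SI: "hrefl (vector [1, 0, 1]) \<in> integral_UJ"
    using hrefl_integral_UJ r i by simp_all
  have "conj_class PU_J_O7 g \<in> {conj_class PU_J_O7 (pclass R_mat), conj_class PU_J_O7 (pclass I_mat)}"
    if g: "is_complex_reflection g" for g
  proof -
    obtain v0 where v0: "Re (herm v0 v0) > 0" "hrefl v0 \<in> integral_UJ" "g = pclass (hrefl v0)"
      using complex_reflection_refl[OF g] .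
    then obtain v where v: "primitive v" "herm v v \<in> {1, 2}" "g = pclass (hrefl v)"
      using integral_reflection_root[OF v0(1,2)] by metis
    show ?thesis
    proof (cases "herm v v = 1")
      case True
      then obtain B where "B \<in> integral_UJ" "B *v vector [0, 1, 0] = v"
        using norm_1_orbit v(1) unfolding primitive_def by blast
      then show ?thesis
        using conj_class_refl[OF _ SR] v(3) by (auto simp: R_mat_eq)
    next
      case False
      then obtain B where "B \<in> integral_UJ" "B *v vector [1, 0, 1] = v"
        using norm_2_orbit v(1,2) by blast
      then show ?thesis
        using conj_class_refl[OF _ SI] v(3) by (auto simp: pclass_I_mat)
    qed
  qed
  then have classes: "{conj_class PU_J_O7 g | g. is_complex_reflection g}
      = {conj_class PU_J_O7 (pclass R_mat), conj_class PU_J_O7 (pclass I_mat)}"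
    using R(1) I(1) r(2) i(2) by auto
  have "conj_class PU_J_O7 (pclass R_mat) \<noteq> conj_class PU_J_O7 (pclass I_mat)"
    unfolding R_mat_eq pclass_I_mat by (rule norm_1_not_conjugate_norm_2[OF r])
  then show ?thesis
    using classes R I r i by simp
qed

end
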